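(* For every integer $r\geq 3$ and every real $\gamma>0$ the following holds asymptotically almost surely (i.e. with probability tending to $1$ as $n\to\infty$) for $\mathcal H=H^{(r)}(n,p)$, for any $p=p(n)\geq \frac{(\ln n)^{17r}}{n^{r-1}}$: every spanning subgraph $H\subseteq \mathcal H$ with $\delta_1(H)\geq \left(\frac{1}{2^{r-1}}+\gamma\right)p\binom{n}{r-1}$ contains a Hamilton Berge cycle.
   Context: $H^{(r)}(n,p)$ denotes the binomial random $r$-uniform hypergraph on vertex set $[n]$ in which each $r$-element subset of $[n]$ is a hyperedge independently with probability $p$. For an $r$-uniform hypergraph $H$, $\deg_H(v)$ is the number of hyperedges containing $v$, and $\delta_1(H)=\min_v \deg_H(v)$. A spanning subgraph of $\mathcal H$ is a hypergraph on the same vertex set whose hyperedges form a subset of those of $\mathcal H$. A Hamilton Berge cycle of a hypergraph on $n$ vertices is an alternating sequence $(v_1,e_1,v_2,\ldots,v_n,e_n)$ of distinct vertices $v_1,\ldots,v_n$ (all vertices of the hypergraph) and distinct hyperedges $e_1,\ldots,e_n$ such that $\{v_1,v_n\}\subseteq e_n$ and $\{v_i,v_{i+1}\}\subseteq e_i$ for every $i\in[n-1]$. *)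

theory Defs
  imports "HOL-Probability.Probability" "HOL-Probability.Product_PMF"
begin

text \<open>A hypergraph is a pair of a vertex set and a set of hyperedges.\<close>

type_synonym 'a hypergraph = "'a set \<times> 'a set set"

abbreviation verts :: "'a hypergraph \<Rightarrow> 'a set" where
  "verts H \<equiv> fst H"

abbreviation hyperedges :: "'a hypergraph \<Rightarrow> 'a set set" where
  "hyperedges H \<equiv> snd H"

definition vertex_degree :: "'a hypergraph \<Rightarrow> 'a \<Rightarrow> nat" where
  "vertex_degree H v = card {e \<in> hyperedges H. v \<in> e}"

definition min_degree :: "'a hypergraph \<Rightarrow> nat" where
  "min_degree H = (MIN v\<in>verts H. vertex_degree H v)"

definition spanning_subgraph :: "'a hypergraph \<Rightarrow> 'a hypergraph \<Rightarrow> bool" where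
  "spanning_subgraph H G \<longleftrightarrow> verts H = verts G \<and> hyperedges H \<subseteq> hyperedges G"

text \<open>
  The alternating sequence \<open>(v\<^sub>1, e\<^sub>1, \<dots>, v\<^sub>n, e\<^sub>n)\<close> is given by its list \<open>vs\<close> of
  vertices and its list \<open>es\<close> of hyperedges; list positions start at \<open>0\<close>.
\<close>

definition hamilton_berge_cycle :: "'a hypergraph \<Rightarrow> 'a list \<Rightarrow> 'a set list \<Rightarrow> bool" where
  "hamilton_berge_cycle H vs es \<longleftrightarrow>
     vs \<noteq> [] \<and> length es = length vs \<and>
     distinct vs \<and> set vs = verts H \<and>
     distinct es \<and> set es \<subseteq> hyperedges H \<and>
     {hd vs, last vs} \<subseteq> last es \<and>
     (\<forall>i. Suc i < length vs \<longrightarrow> {vs ! i, vs ! Suc i} \<subseteq> es ! i)"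

definition has_hamilton_berge_cycle :: "'a hypergraph \<Rightarrow> bool" where
  "has_hamilton_berge_cycle H \<longleftrightarrow> (\<exists>vs es. hamilton_berge_cycle H vs es)"

definition uniform_edges :: "nat \<Rightarrow> nat \<Rightarrow> nat set set" where
  "uniform_edges r n = {e. e \<subseteq> {1..n} \<and> card e = r}"

text \<open>
  The binomial random hypergraph \<open>H\<^sup>(\<^sup>r\<^sup>)(n,p)\<close>: an independent coin with success
  probability \<open>p\<close> is tossed for each \<open>r\<close>-element subset of \<open>{1..n}\<close>. Note that
  \<open>bernoulli_pmf\<close> truncates its parameter to \<open>[0,1]\<close>, so this is meaningful only for
  \<open>0 \<le> p \<le> 1\<close>.
\<close>

definition random_hypergraph :: "nat \<Rightarrow> nat \<Rightarrow> real \<Rightarrow> nat hypergraph pmf" where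
  "random_hypergraph r n p =
     map_pmf (\<lambda>coin. ({1..n}, {e \<in> uniform_edges r n. coin e}))
       (Pi_pmf (uniform_edges r n) False (\<lambda>_. bernoulli_pmf p))"

end

theory Submission
  imports Defs "HOL-Real_Asymp.Real_Asymp"
begin

text \<open>
  The proof is a rotation-extension argument combined with union bounds over sparse objects.
  Colour the \<open>r\<close>-sets at random so that three colour classes of the random hypergraph have
  expected degrees \<open>ln\<^sup>2 n\<close>, \<open>ln\<^sup>4 n\<close> and \<open>ln\<^sup>6 n\<close>, and assign each hyperedge of the first
  class to one of its own vertices. Given \<open>H\<close>, some colouring splits its degrees proportionally.
  In a longest Berge path, rotations that use a hyperedge assigned to the current end give
  \<open>\<epsilon> n\<close> ends: by Posa's lemma all these hyperedges lie inside a set at most three times as large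
  as the set of ends, which is too dense for a small set. One further rotation with
  the second class gives more than \<open>n/2\<close> ends, since otherwise the link of a linear number of
  vertices is confined to half of the vertices, which happens for a fraction \<open>2\<^sup>1\<^sup>-\<^sup>r\<close> of the
  hyperedges only. For the same reason the third class closes the path to a cycle, which
  can be opened again and prolonged unless it is spanning. The confining sets depend only on the path
  and on the sparser classes, so they are few compared with the Chernoff bound for the next class.
\<close>

section \<open>Berge paths\<close>

text \<open>The subgraph \<open>H\<close> is chosen after the randomness, and there are too many
  subgraphs for a union bound over all of them. What has to be enumerated is only what the confining
  sets depend on: a path, a vertex set and the part of \<open>H\<close> in the sparser classes.
  Encoded by lists, these number about exp (C D n ln n), where D is the largest expected degree of a
  class already used, while trapping a linear number of vertices in the next class, of expected
  degree D', has probability about exp (- c D' n). Hence D' must outgrow D ln n, which the steps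
  from ln^2 n to ln^4 n to ln^6 n achieve; the first exponent exceeds 1 so that exp (- c ln^2 n)
  beats a factor n.

  The colours are independent of the coins: for most hypergraphs fewer than half of the colourings
  are bad, and for each admissible \<open>H\<close> more than half split its degrees well. This
  yields a good colouring for every \<open>H\<close> without any sum over \<open>H\<close>.

  Assigning the hyperedges of the first class to vertices meets another obstacle: otherwise a
  rotated path might already use many of the hyperedges at its own end.\<close>

fun linked :: "('a \<Rightarrow> 'e \<Rightarrow> 'a \<Rightarrow> bool) \<Rightarrow> 'a list \<Rightarrow> 'e list \<Rightarrow> bool" where
  "linked J [] es = False"
| "linked J [v] es = (es = [])"
| "linked J (u # v # vs) [] = False"
| "linked J (u # v # vs) (e # es) = (J u e v \<and> linked J (v # vs) es)"

lemma linked_length: "linked J vs es \<Longrightarrow> length vs = Suc (length es)"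
  by (induction J vs es rule: linked.induct) auto

lemma linked_append:
  assumes "length vs1 = Suc (length es1)" "vs2 \<noteq> []"
  shows "linked J (vs1 @ vs2) (es1 @ e # es2) \<longleftrightarrow>
    linked J vs1 es1 \<and> J (last vs1) e (hd vs2) \<and> linked J vs2 es2"
  using assms
proof (induction es1 arbitrary: vs1)
  case Nil
  then obtain v where "vs1 = [v]" by (cases vs1) auto
  then show ?case using Nil by (cases vs2) auto
next
  case (Cons a es1)
  then obtain v w vs where "vs1 = v # w # vs"
    by (metis length_Suc_conv)
  then show ?case using Cons.IH[of "w # vs"] Cons.prems by auto
qed

lemma linked_splitE:
  assumes "linked J (vs1 @ vs2) es" "vs1 \<noteq> []" "vs2 \<noteq> []"
  obtains es1 e es2 where "es = es1 @ e # es2" "length vs1 = Suc (length es1)"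
    "linked J vs1 es1" "J (last vs1) e (hd vs2)" "linked J vs2 es2"
proof -
  define i where "i = length vs1 - 1"
  have "i < length es"
    using linked_length[OF assms(1)] assms(2,3) unfolding i_def
    by (cases vs1; cases vs2) auto
  then have eq: "es = take i es @ es ! i # drop (Suc i) es"
    by (simp add: id_take_nth_drop)
  have "length vs1 = Suc (length (take i es))"
    using \<open>i < length es\<close> assms(2) i_def by (cases vs1) auto
  with that[OF eq] linked_append[OF _ assms(3), of vs1 "take i es" J "es ! i" "drop (Suc i) es"]
    assms(1) eq show ?thesis by metis
qed

lemma linked_rev:
  assumes "linked J vs es" "\<And>u e v. J u e v \<Longrightarrow> J v e u"
  shows "linked J (rev vs) (rev es)"
  using assms(1)
proof (induction vs arbitrary: es)
  case Nil
  then show ?case by simp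
next
  case (Cons u vs)
  show ?case
  proof (cases vs)
    case Nil
    then show ?thesis using Cons by auto
  next
    case (Cons v ws)
    then obtain e es' where es: "es = e # es'"
      using Cons.prems by (cases es) auto
    have *: "J u e v" "linked J (rev vs) (rev es')"
      using Cons.prems Cons.IH[of es'] Cons es by auto
    have "linked J (rev vs @ [u]) (rev es' @ e # [])"
      using * linked_length[OF *(2)] assms(2) Cons
      by (subst linked_append) (auto simp: last_rev)
    then show ?thesis by (simp add: es)
  qed
qed

lemma linked_nth:
  "linked J vs es \<Longrightarrow> Suc i < length vs \<Longrightarrow> J (vs ! i) (es ! i) (vs ! Suc i)"
proof (induction J vs es arbitrary: i rule: linked.induct)
  case (4 J u v vs e es)
  then show ?case by (cases i) auto
qed auto

lemma linked_edge_ends: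
  assumes "linked J vs es" "e \<in> set es"
  obtains u v where "u \<in> set vs" "v \<in> set vs" "J u e v"
  using assms
proof -
  from assms(2) obtain i where i: "i < length es" "es ! i = e"
    by (auto simp: in_set_conv_nth)
  then have "Suc i < length vs" using linked_length[OF assms(1)] by simp
  then show ?thesis using linked_nth[OF assms(1), of i] i that by (metis Suc_lessD nth_mem)
qed

section \<open>Neighbouring pairs on a path\<close>

fun consecutive :: "'a list \<Rightarrow> 'a set set" where
  "consecutive (u # v # vs) = insert {u, v} (consecutive (v # vs))"
| "consecutive vs = {}"

lemma consecutive_append:
  assumes "xs \<noteq> []" "ys \<noteq> []"
  shows "consecutive (xs @ ys) = consecutive xs \<union> {{last xs, hd ys}} \<union> consecutive ys"
  using assms
proof (induction xs rule: consecutive.induct)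
  case ("2_2" v)
  then show ?case by (cases ys) auto
qed auto

lemma consecutive_rev: "consecutive (rev xs) = consecutive xs"
proof (induction xs)
  case (Cons x xs)
  then show ?case
  proof (cases xs)
    case (Cons y ys)
    then have "consecutive (rev xs @ [x]) = consecutive (rev xs) \<union> {{last (rev xs), hd [x]}} \<union> consecutive [x]"
      by (intro consecutive_append) auto
    also have "\<dots> = consecutive (x # xs)"
      using Cons.IH Cons by (auto simp: last_rev insert_commute)
    finally show ?thesis by simp
  qed auto
qed auto

lemma consecutive_subset: "e \<in> consecutive vs \<Longrightarrow> e \<subseteq> set vs"
  by (induction vs rule: consecutive.induct) auto

lemma card_consecutive_neighbours:
  assumes "distinct vs"
  shows "finite {u. {u, s} \<in> consecutive vs} \<and>
    card {u. {u, s} \<in> consecutive vs} \<le> (if vs \<noteq> [] \<and> s = hd vs then 1 else 2)"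
  using assms
proof (induction vs rule: consecutive.induct)
  case (1 x y zs)
  show ?case
  proof (cases "s = x")
    case True
    then have "{u. {u, s} \<in> consecutive (x # y # zs)} \<subseteq> {y}"
      using 1 consecutive_subset[of _ "y # zs"] by (fastforce simp: doubleton_eq_iff)
    then show ?thesis using True card_mono[of "{y}"] by (auto intro: finite_subset)
  next
    case False
    then have *: "{u. {u, s} \<in> consecutive (x # y # zs)} =
       {u. {u, s} \<in> consecutive (y # zs)} \<union> (if s = y then {x} else {})"
      by (auto simp: doubleton_eq_iff)
    show ?thesis unfolding * using 1 False
      by (auto simp: card_insert_if split: if_splits)
  qed
qed auto

section \<open>Paths with assigned hyperedges, their rotations and their ends\<close>

type_synonym 'a bpath = "'a list \<times> 'a set list"

text \<open>A relation \<open>R\<close> assigns hyperedges to vertices. A hyperedge assigned to \<open>w\<close> may only be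
  used for a step at \<open>w\<close>, so at most one hyperedge assigned to the end of a path is
  already used by the path.\<close>

definition berge_step :: "('a \<times> 'a set) set \<Rightarrow> 'a \<Rightarrow> 'a set \<Rightarrow> 'a \<Rightarrow> bool" where
  "berge_step R u e v \<longleftrightarrow> u \<in> e \<and> v \<in> e \<and> (\<forall>w. (w, e) \<in> R \<longrightarrow> w = u \<or> w = v)"

lemma berge_step_sym: "berge_step R u e v \<Longrightarrow> berge_step R v e u"
  by (auto simp: berge_step_def)

text \<open>The removed hyperedge \<open>f\<close> lies between \<open>xs\<close> and
  \<open>ys\<close>; the new \<open>e\<close> joins the old end to \<open>last xs\<close>, so
  \<open>hd ys\<close> becomes the end and the start never moves. As \<open>e\<close> must be
  assigned to the old end, the reachable paths are determined by \<open>R\<close> and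
  \<open>P\<close> alone.\<close>

inductive rotations :: "('a \<times> 'a set) set \<Rightarrow> 'a bpath \<Rightarrow> 'a bpath \<Rightarrow> bool"
  for R P where
  refl: "rotations R P P"
| step: "rotations R P (xs @ ys, es1 @ f # es2) \<Longrightarrow> ys \<noteq> [] \<Longrightarrow>
    length xs = Suc (length es1) \<Longrightarrow> (last ys, e) \<in> R \<Longrightarrow> e \<notin> set (es1 @ f # es2) \<Longrightarrow>
    last xs \<in> e \<Longrightarrow> rotations R P (xs @ rev ys, es1 @ e # rev es2)"

definition endpoints :: "('a \<times> 'a set) set \<Rightarrow> 'a bpath \<Rightarrow> 'a set" where
  "endpoints R P = {last (fst Q) | Q. rotations R P Q}"

text \<open>A fixed choice turns all sets derived from rotated paths into functions of
  \<open>R\<close> and \<open>P\<close>, which is what allows them to be enumerated later.\<close>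

definition path_to :: "('a \<times> 'a set) set \<Rightarrow> 'a bpath \<Rightarrow> 'a \<Rightarrow> 'a bpath" where
  "path_to R P s = (SOME Q. rotations R P Q \<and> last (fst Q) = s)"

definition succs :: "'a list \<Rightarrow> ('a \<times> 'a) set" where
  "succs vs = set (zip vs (tl vs))"

definition reverse_path :: "'a bpath \<Rightarrow> 'a bpath" where
  "reverse_path P = (rev (fst P), rev (snd P))"

definition pivots :: "('a \<times> 'a set) set \<Rightarrow> 'a bpath \<Rightarrow> 'a set \<Rightarrow> 'a \<Rightarrow> 'a set" where
  "pivots R P T s = {u. \<exists>t\<in>T. (u, t) \<in> succs (fst (path_to R P s))}"

text \<open>Excluding the hyperedges of \<open>P\<close> itself is enough: rotating brings in
  nothing but assigned hyperedges, and \<open>F\<close> will contain none of these.\<close>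

definition new_ends :: "('a \<times> 'a set) set \<Rightarrow> 'a bpath \<Rightarrow> 'a set set \<Rightarrow> 'a set" where
  "new_ends R P F = {t. \<exists>s\<in>endpoints R P. \<exists>e\<in>F - set (snd P). s \<in> e \<and>
     (\<exists>u\<in>e. (u, t) \<in> succs (fst (path_to R P s)))}"

text \<open>Reversal makes the end \<open>a\<close> the fixed start, so these are the possible
  partners of \<open>a\<close> at the opposite end of a path.\<close>

definition other_ends :: "('a \<times> 'a set) set \<Rightarrow> 'a bpath \<Rightarrow> 'a set set \<Rightarrow> 'a \<Rightarrow> 'a set" where
  "other_ends R P F a = new_ends R (reverse_path (path_to R P a)) F"

lemma path_to: "s \<in> endpoints R P \<Longrightarrow> rotations R P (path_to R P s) \<and> last (fst (path_to R P s)) = s"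
  unfolding endpoints_def path_to_def by (rule someI_ex) auto

lemma succsE:
  assumes "(u, t) \<in> succs vs"
  obtains xs ys where "vs = xs @ ys" "xs \<noteq> []" "ys \<noteq> []" "last xs = u" "hd ys = t"
proof -
  from assms obtain i where "i < length vs - 1" "vs ! i = u" "vs ! Suc i = t"
    by (auto simp: succs_def in_set_zip nth_tl)
  then have i: "i < length vs" "Suc i < length vs" "vs ! i = u" "vs ! Suc i = t"
    by auto
  show ?thesis
  proof (rule that[of "take (Suc i) vs" "drop (Suc i) vs"])
    show "last (take (Suc i) vs) = u" using i by (simp add: take_Suc_conv_app_nth)
    show "hd (drop (Suc i) vs) = t" using i by (simp add: hd_drop_conv_nth)
  qed (use i in auto)
qed

lemma succsI: "xs \<noteq> [] \<Longrightarrow> ys \<noteq> [] \<Longrightarrow> (last xs, hd ys) \<in> succs (xs @ ys)"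
proof (induction xs)
  case (Cons x xs)
  then show ?case by (cases xs; cases ys) (auto simp: succs_def)
qed auto

lemma succs_exists:
  assumes "u \<in> set vs" "u \<noteq> last vs"
  obtains t xs ys where "vs = xs @ ys" "xs \<noteq> []" "ys \<noteq> []" "last xs = u" "hd ys = t" "(u, t) \<in> succs vs"
proof -
  obtain xs ys where v: "vs = xs @ u # ys" using assms(1) by (auto dest: split_list)
  then have "ys \<noteq> []" using assms(2) by auto
  then show ?thesis using that[of "xs @ [u]" ys "hd ys"] v succsI[of "xs @ [u]" ys] by auto
qed

text \<open>On a path without repetitions each vertex of \<open>T\<close> has at most one
  predecessor.\<close>

lemma card_pivots:
  assumes "distinct (fst (path_to R P s))" "finite T"
  shows "card (pivots R P T s) \<le> card T"
proof -
  define vs where "vs = fst (path_to R P s)"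
  define Z where "Z = {x \<in> set (zip vs (tl vs)). snd x \<in> T}"
  have "pivots R P T s = fst ` Z"
    by (force simp: pivots_def succs_def Z_def vs_def)
  then have "card (pivots R P T s) \<le> card Z"
    by (auto simp: Z_def intro: card_image_le)
  also have "\<dots> = card (snd ` Z)"
  proof (rule card_image[symmetric])
    have "distinct (tl vs)" using assms(1) vs_def by (simp add: distinct_tl)
    then show "inj_on snd Z"
      unfolding Z_def by (auto simp: inj_on_def in_set_zip nth_eq_iff_index_eq)
  qed
  also have "\<dots> \<le> card T" using assms(2) by (auto simp: Z_def intro!: card_mono)
  finally show ?thesis .
qed

section \<open>Rotations\<close>

text \<open>A rotation replaces only the pair of \<open>last xs\<close> and \<open>hd ys\<close> by
  the pair of \<open>last xs\<close> and \<open>last ys\<close>. Both \<open>last ys\<close> and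
  \<open>hd ys\<close> are ends, so \<open>z\<close> could be affected only as
  \<open>last xs\<close>; but then \<open>z\<close> would still have its old neighbours and the end
  \<open>hd ys\<close> would be one of them.\<close>

lemma posa_neighbours:
  assumes "rotations R P Q"
    and "z \<notin> endpoints R P" "\<And>s. s \<in> endpoints R P \<Longrightarrow> {z, s} \<notin> consecutive (fst P)"
  shows "{z, v} \<in> consecutive (fst Q) \<longleftrightarrow> {z, v} \<in> consecutive (fst P)"
  using assms(1)
proof (induction arbitrary: v)
  case (step xs ys es1 f es2 e)
  note IH = step.IH[unfolded fst_conv]
  have ne: "xs \<noteq> []" "ys \<noteq> []" using step.hyps by auto
  have s: "last ys \<in> endpoints R P"
    unfolding endpoints_def using step.hyps(1) ne
    by (intro CollectI exI[of _ "(xs @ ys, es1 @ f # es2)"]) simp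
  have "rotations R P (xs @ rev ys, es1 @ e # rev es2)"
    using step.hyps by (rule rotations.step)
  then have w': "hd ys \<in> endpoints R P"
    unfolding endpoints_def using ne
    by (intro CollectI exI[of _ "(xs @ rev ys, es1 @ e # rev es2)"]) (simp add: last_rev)
  have z1: "z \<noteq> last xs"
  proof
    assume "z = last xs"
    then have "{z, hd ys} \<in> consecutive (xs @ ys)"
      using ne by (simp add: consecutive_append)
    then show False using IH assms(3)[OF w'] by simp
  qed
  have z2: "z \<noteq> last ys" "z \<noteq> hd ys" using s w' assms(2) by auto
  have "{z, v} \<in> consecutive (xs @ rev ys) \<longleftrightarrow> {z, v} \<in> consecutive (xs @ ys)"
    using ne z1 z2 by (auto simp: consecutive_append consecutive_rev hd_rev doubleton_eq_iff)
  then show ?case using IH by simp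
qed auto

text \<open>The bound \<open>3 * m\<close> and the factor 3 in \<open>few_inside\<close> reflect
  Posa's lemma: a set of ends together with its neighbours on a path is at most three times as
  large. There is \<open>k - 1\<close> in place of \<open>k\<close> because one hyperedge assigned
  to an end may already be on the path.\<close>

locale berge_expander =
  fixes V :: "'a set" and E :: "'a set set" and R :: "('a \<times> 'a set) set"
    and F G :: "'a set set" and k m :: nat
  assumes finite_V: "finite V" and V_nonempty: "V \<noteq> {}"
    and edges: "e \<in> E \<Longrightarrow> e \<subseteq> V"
    and R_edge: "(v, e) \<in> R \<Longrightarrow> e \<in> E \<and> v \<in> e"
    and R_unique: "(v, e) \<in> R \<Longrightarrow> (w, e) \<in> R \<Longrightarrow> v = w"
    and k_pos: "k > 0"
    and R_degree: "v \<in> V \<Longrightarrow> k \<le> card {e. (v, e) \<in> R}"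
    and F_edge: "F \<subseteq> E" "F \<inter> snd ` R = {}"
    and G_edge: "G \<subseteq> E" "G \<inter> snd ` R = {}"
    and few_inside: "Y \<subseteq> V \<Longrightarrow> Y \<noteq> {} \<Longrightarrow> card Y \<le> 3 * m \<Longrightarrow>
      3 * card {e \<in> snd ` R. e \<subseteq> Y} < (k - 1) * card Y"
begin

definition berge_path :: "'a bpath \<Rightarrow> bool" where
  "berge_path P \<longleftrightarrow> linked (berge_step R) (fst P) (snd P) \<and> distinct (fst P) \<and> distinct (snd P) \<and>
     set (fst P) \<subseteq> V \<and> set (snd P) \<subseteq> E"

definition longest_path :: "'a bpath \<Rightarrow> bool" where
  "longest_path P \<longleftrightarrow> berge_path P \<and> (\<forall>Q. berge_path Q \<longrightarrow> length (fst Q) \<le> length (fst P))"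

lemma finite_E: "finite E"
proof (rule finite_subset)
  show "E \<subseteq> Pow V" using edges by blast
qed (simp add: finite_V)

lemma finite_R: "finite R"
proof (rule finite_subset)
  show "R \<subseteq> V \<times> E" by (auto dest!: R_edge dest: edges[THEN subsetD])
qed (simp add: finite_V finite_E)

lemma finite_R_at: "finite {e. (v, e) \<in> R}"
proof (rule finite_subset)
  show "{e. (v, e) \<in> R} \<subseteq> E" using R_edge by blast
qed (rule finite_E)

lemma R_stepI: "(v, e) \<in> R \<Longrightarrow> u \<in> e \<Longrightarrow> berge_step R u e v"
  using R_edge[of v e] R_unique[of v e] unfolding berge_step_def by blast

lemma free_stepI: "e \<notin> snd ` R \<Longrightarrow> u \<in> e \<Longrightarrow> v \<in> e \<Longrightarrow> berge_step R u e v"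
  unfolding berge_step_def by (metis image_eqI snd_conv)

section \<open>Longest Berge paths and Posa's lemma\<close>

lemma berge_path_rotate:
  assumes "berge_path (xs @ ys, es1 @ f # es2)" "length xs = Suc (length es1)" "ys \<noteq> []"
    and "e \<in> E" "e \<notin> set (es1 @ f # es2)" "berge_step R (last xs) e (last ys)"
  shows "berge_path (xs @ rev ys, es1 @ e # rev es2)"
proof -
  have *: "linked (berge_step R) xs es1 \<and> linked (berge_step R) ys es2"
    using assms(1) linked_append[OF assms(2,3)] by (auto simp: berge_path_def)
  then have "linked (berge_step R) (xs @ rev ys) (es1 @ e # rev es2)"
    using assms(2,3,6) linked_rev[of "berge_step R" ys es2, OF conjunct2[OF *] berge_step_sym[of R]]
    by (subst linked_append) (auto simp: hd_rev)
  then show ?thesis using assms by (auto simp: berge_path_def)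
qed

lemma berge_path_extend:
  assumes "berge_path (xs, es)" "e \<in> E" "e \<notin> set es" "x \<notin> set xs" "berge_step R (last xs) e x"
  shows "berge_path (xs @ [x], es @ [e])"
proof -
  have "linked (berge_step R) (xs @ [x]) (es @ e # [])"
    using assms linked_length[of "berge_step R" xs es]
    by (subst linked_append) (auto simp: berge_path_def)
  moreover have "x \<in> V" using assms(2,5) edges by (auto simp: berge_step_def)
  ultimately show ?thesis using assms by (auto simp: berge_path_def)
qed

lemma rotations_berge_path:
  assumes "rotations R P Q" "berge_path P"
  shows "berge_path Q \<and> set (fst Q) = set (fst P) \<and> length (fst Q) = length (fst P) \<and>
    hd (fst Q) = hd (fst P) \<and> set (snd Q) \<subseteq> set (snd P) \<union> snd ` R"
  using assms(1)
proof induction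
  case (step xs ys es1 f es2 e)
  have "xs \<noteq> []" using step.hyps by auto
  moreover have "berge_path (xs @ rev ys, es1 @ e # rev es2)"
    using step R_edge[of "last ys" e] R_stepI[of "last ys" e "last xs"]
    by (intro berge_path_rotate) auto
  moreover have "e \<in> snd ` R" using step.hyps(4) by force
  ultimately show ?case using step.IH by auto
qed (use assms in auto)

lemma longest_path_rotations:
  "rotations R P Q \<Longrightarrow> longest_path P \<Longrightarrow> longest_path Q"
  using rotations_berge_path[of P Q] unfolding longest_path_def by simp

lemma longest_path_reverse:
  assumes "longest_path P"
  shows "longest_path (reverse_path P)"
proof -
  have "linked (berge_step R) (rev (fst P)) (rev (snd P))"
    using assms by (intro linked_rev) (auto simp: longest_path_def berge_path_def berge_step_sym)
  then have "berge_path (reverse_path P)"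
    using assms by (auto simp: longest_path_def reverse_path_def berge_path_def)
  then show ?thesis using assms by (simp add: longest_path_def reverse_path_def)
qed

lemma longest_path_closed:
  assumes "longest_path Q" "e \<in> E" "e \<notin> set (snd Q)" "berge_step R (last (fst Q)) e u"
  shows "u \<in> set (fst Q)"
proof (rule ccontr)
  assume "u \<notin> set (fst Q)"
  then have "berge_path (fst Q @ [u], snd Q @ [e])"
    using assms by (intro berge_path_extend) (auto simp: longest_path_def)
  then show False using assms(1) unfolding longest_path_def by force
qed

lemma longest_path_exists: "\<exists>P. longest_path P"
proof -
  obtain v where "v \<in> V" using V_nonempty by auto
  then have "berge_path ([v], [])" by (simp add: berge_path_def)
  moreover have "\<forall>P. berge_path P \<longrightarrow> length (fst P) < Suc (card V)"
    by (metis berge_path_def card_mono distinct_card finite_V le_imp_less_Suc)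
  ultimately show ?thesis
    using ex_has_greatest_nat[of berge_path "([v], [])" "\<lambda>P. length (fst P)" "Suc (card V)"]
    unfolding longest_path_def by blast
qed

text \<open>A step through a hyperedge assigned to \<open>w\<close> must have \<open>w\<close> as
  one of its two vertices, and the end of a path without repetitions takes part in the last step
  only.\<close>

lemma used_at_end:
  assumes "berge_path Q"
  shows "{e. (last (fst Q), e) \<in> R \<and> e \<in> set (snd Q)} \<subseteq> {last (snd Q)}"
proof
  fix e assume "e \<in> {e. (last (fst Q), e) \<in> R \<and> e \<in> set (snd Q)}"
  then have e: "(last (fst Q), e) \<in> R" "e \<in> set (snd Q)" by auto
  then obtain i where i: "i < length (snd Q)" "snd Q ! i = e" by (auto simp: in_set_conv_nth)
  have l: "linked (berge_step R) (fst Q) (snd Q)" and d: "distinct (fst Q)"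
    using assms by (auto simp: berge_path_def)
  have len: "length (fst Q) = Suc (length (snd Q))" using linked_length[OF l] .
  then have "berge_step R (fst Q ! i) e (fst Q ! Suc i)"
    using linked_nth[OF l, of i] i by simp
  then have "last (fst Q) = fst Q ! i \<or> last (fst Q) = fst Q ! Suc i"
    using e(1) by (auto simp: berge_step_def)
  moreover have "last (fst Q) = fst Q ! length (snd Q)"
    using len by (metis diff_Suc_1 last_conv_nth length_0_conv nat.distinct(1))
  ultimately have "i = length (snd Q) \<or> Suc i = length (snd Q)"
    using d len i(1) nth_eq_iff_index_eq[OF d] by (metis Suc_mono less_Suc_eq)
  then have "Suc i = length (snd Q)" using i(1) by auto
  then have "e = last (snd Q)" using i(2)
    by (metis diff_Suc_1 last_conv_nth length_0_conv nat.distinct(1))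
  then show "e \<in> {last (snd Q)}" by simp
qed

text \<open>Maximality puts every vertex \<open>u\<close> of \<open>e\<close> on the path. Rotating
  at \<open>u\<close> makes the successor \<open>t\<close> of \<open>u\<close> an end; if
  \<open>u\<close> were neither an end nor next to one on \<open>P\<close>, its neighbours would be
  the same on all rotated paths, and \<open>t\<close> would be a neighbour of \<open>u\<close> on
  \<open>P\<close>.\<close>

lemma posa_closed:
  assumes "longest_path P" "s \<in> endpoints R P" "(s, e) \<in> R" "e \<notin> set (snd (path_to R P s))"
  shows "e \<subseteq> endpoints R P \<union> {u. \<exists>s\<in>endpoints R P. {u, s} \<in> consecutive (fst P)}"
proof
  fix u assume u: "u \<in> e"
  let ?Q = "path_to R P s"
  have rot: "rotations R P ?Q" and l: "last (fst ?Q) = s" using path_to[OF assms(2)] by auto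
  have mx: "longest_path ?Q" using longest_path_rotations[OF rot assms(1)] .
  show "u \<in> endpoints R P \<union> {u. \<exists>s\<in>endpoints R P. {u, s} \<in> consecutive (fst P)}"
  proof (cases "u = s")
    case False
    have "u \<in> set (fst ?Q)"
      using longest_path_closed[OF mx _ assms(4)] R_edge[OF assms(3)] R_stepI[OF assms(3) u] l
        berge_step_sym by metis
    then obtain t xs ys where v: "fst ?Q = xs @ ys" "xs \<noteq> []" "ys \<noteq> []" "last xs = u" "hd ys = t"
      using succs_exists[of u "fst ?Q"] False l by metis
    have "linked (berge_step R) (xs @ ys) (snd ?Q)"
      using mx v by (auto simp: longest_path_def berge_path_def)
    then obtain es1 f es2 where es: "snd ?Q = es1 @ f # es2" "length xs = Suc (length es1)"
      using linked_splitE[OF _ v(2,3)] by metis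
    have Q: "?Q = (xs @ ys, es1 @ f # es2)" using v es by (metis prod.collapse)
    have "last ys = s" using l v by auto
    then have "rotations R P (xs @ rev ys, es1 @ e # rev es2)"
      using rot es v assms(3,4) u by (intro rotations.step[where f = f]) (auto simp flip: Q)
    then have t: "t \<in> endpoints R P"
      unfolding endpoints_def using v
      by (intro CollectI exI[of _ "(xs @ rev ys, es1 @ e # rev es2)"]) (simp add: last_rev)
    have "{u, t} \<in> consecutive (fst ?Q)" using v by (simp add: consecutive_append)
    then show ?thesis using posa_neighbours[OF rot, of u t] t by blast
  qed (use assms in auto)
qed

text \<open>Each end keeps at least \<open>k - 1\<close> assigned hyperedges off its path, and these
  sets are disjoint for different ends because a hyperedge is assigned to one vertex. Otherwise the
  count could not be compared with \<open>few_inside\<close>.\<close>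

lemma many_endpoints:
  assumes "longest_path P"
  shows "m < card (endpoints R P)"
proof (rule ccontr)
  assume "\<not> m < card (endpoints R P)"
  define S where "S = endpoints R P"
  define N where "N = {u. \<exists>s\<in>S. {u, s} \<in> consecutive (fst P)}"
  define free where "free = (\<lambda>s. {e. (s, e) \<in> R \<and> e \<notin> set (snd (path_to R P s))})"
  have P: "berge_path P" using assms by (simp add: longest_path_def)
  have cS: "card S \<le> m" using \<open>\<not> m < card (endpoints R P)\<close> S_def by simp
  have S_sub: "S \<subseteq> set (fst P)"
  proof
    fix s assume "s \<in> S"
    then obtain Q where Q: "rotations R P Q" "last (fst Q) = s" by (auto simp: S_def endpoints_def)
    from rotations_berge_path[OF Q(1) P]
    have "set (fst Q) = set (fst P)" "berge_path Q" by blast+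
    moreover have "fst Q \<noteq> []" using linked_length calculation(2) by (metis berge_path_def list.size(3) nat.distinct(1))
    ultimately show "s \<in> set (fst P)" using Q(2) last_in_set by metis
  qed
  have SV: "S \<subseteq> V" using S_sub P by (auto simp: berge_path_def)
  have finS: "finite S" using SV finite_V finite_subset by auto
  have "last (fst P) \<in> S" unfolding S_def endpoints_def using rotations.refl by blast
  then have ne: "S \<noteq> {}" by auto
  have N_eq: "N = (\<Union>s\<in>S. {u. {u, s} \<in> consecutive (fst P)})" by (auto simp: N_def)
  have c: "finite {u. {u, s} \<in> consecutive (fst P)}" "card {u. {u, s} \<in> consecutive (fst P)} \<le> 2" for s
    using card_consecutive_neighbours[of "fst P" s] P by (auto simp: berge_path_def split: if_splits)
  have "card N \<le> (\<Sum>s\<in>S. card {u. {u, s} \<in> consecutive (fst P)})"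
    unfolding N_eq by (rule card_UN_le[OF finS])
  also have "\<dots> \<le> (\<Sum>s\<in>S. 2)" by (intro sum_mono c)
  finally have "card N \<le> 2 * card S" by simp
  then have cY: "card (S \<union> N) \<le> 3 * card S" using card_Un_le[of S N] by linarith
  have NV: "N \<subseteq> V"
    using P consecutive_subset[of _ "fst P"] by (fastforce simp: N_def berge_path_def)
  have fr: "k - 1 \<le> card (free s)" if "s \<in> S" for s
  proof -
    let ?Q = "path_to R P s"
    have Q: "rotations R P ?Q" "last (fst ?Q) = s" using path_to[of s R P] that by (auto simp: S_def)
    then have "card {e. (s, e) \<in> R \<and> e \<in> set (snd ?Q)} \<le> card {last (snd ?Q)}"
      using used_at_end[of ?Q] rotations_berge_path[OF Q(1) P] by (intro card_mono) auto
    moreover have "{e. (s, e) \<in> R} = free s \<union> {e. (s, e) \<in> R \<and> e \<in> set (snd ?Q)}"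
      by (auto simp: free_def)
    ultimately show ?thesis
      using R_degree[of s] that SV card_Un_le[of "free s" "{e. (s, e) \<in> R \<and> e \<in> set (snd ?Q)}"] by auto
  qed
  have "(k - 1) * card S = (\<Sum>s\<in>S. k - 1)" by simp
  also have "\<dots> \<le> (\<Sum>s\<in>S. card (free s))" by (intro sum_mono fr)
  also have "\<dots> = card (\<Union>s\<in>S. free s)"
  proof (rule card_UN_disjoint[symmetric])
    show "\<forall>s\<in>S. finite (free s)" using finite_R_at by (auto simp: free_def)
    show "\<forall>i\<in>S. \<forall>j\<in>S. i \<noteq> j \<longrightarrow> free i \<inter> free j = {}" using R_unique by (auto simp: free_def)
  qed (rule finS)
  also have "\<dots> \<le> card {e \<in> snd ` R. e \<subseteq> S \<union> N}"
  proof (rule card_mono)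
    show "(\<Union>s\<in>S. free s) \<subseteq> {e \<in> snd ` R. e \<subseteq> S \<union> N}"
    proof safe
      fix s e assume "s \<in> S" "e \<in> free s"
      then show "e \<in> snd ` R" by (force simp: free_def)
    next
      fix s e x assume "s \<in> S" "e \<in> free s" "x \<in> e" "x \<notin> N"
      then show "x \<in> S"
        using posa_closed[OF assms, of s e] by (auto simp: free_def S_def N_def)
    qed
  qed (use finite_R in auto)
  finally have "3 * ((k - 1) * card S) \<le> 3 * card {e \<in> snd ` R. e \<subseteq> S \<union> N}" by simp
  also have "\<dots> < (k - 1) * card (S \<union> N)"
    using SV NV ne cY cS by (intro few_inside) auto
  also have "\<dots> \<le> (k - 1) * (3 * card S)" using cY by (intro mult_le_mono2)
  finally show False by simp
qed

lemma endpoints_subset: "berge_path P \<Longrightarrow> endpoints R P \<subseteq> V"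
proof
  fix s assume P: "berge_path P" and "s \<in> endpoints R P"
  then obtain Q where Q: "rotations R P Q" "last (fst Q) = s" by (auto simp: endpoints_def)
  have "linked (berge_step R) (fst Q) (snd Q)" "set (fst Q) \<subseteq> V"
    using rotations_berge_path[OF Q(1) P] unfolding berge_path_def by auto
  then show "s \<in> V" using Q(2) by (cases "fst Q") (auto split: if_splits)
qed

lemma new_endsE:
  assumes "longest_path P" "t \<in> new_ends R P F"
  obtains Q where "longest_path Q" "last (fst Q) = t" "hd (fst Q) = hd (fst P)" "t \<noteq> hd (fst P)"
    "set (fst Q) = set (fst P)" "set (snd Q) \<subseteq> set (snd P) \<union> snd ` R \<union> F"
proof -
  from assms(2) obtain s e u where s: "s \<in> endpoints R P" and e: "e \<in> F" "e \<notin> set (snd P)" "s \<in> e" "u \<in> e"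
    and ut: "(u, t) \<in> succs (fst (path_to R P s))"
    by (auto simp: new_ends_def)
  let ?Q = "path_to R P s"
  have rot: "rotations R P ?Q" and l: "last (fst ?Q) = s" using path_to[OF s] by auto
  have P: "berge_path P" using assms(1) by (simp add: longest_path_def)
  note Q = rotations_berge_path[OF rot P]
  obtain xs ys where v: "fst ?Q = xs @ ys" "xs \<noteq> []" "ys \<noteq> []" "last xs = u" "hd ys = t"
    using succsE[OF ut] by metis
  have "linked (berge_step R) (xs @ ys) (snd ?Q)"
    using Q v by (auto simp: berge_path_def)
  then obtain es1 f es2 where es: "snd ?Q = es1 @ f # es2" "length xs = Suc (length es1)"
    using linked_splitE[OF _ v(2,3)] by metis
  have Qeq: "?Q = (xs @ ys, es1 @ f # es2)" using v es by (metis prod.collapse)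
  have lys: "last ys = s" using l v by auto
  have eR: "e \<notin> snd ` R" and eE: "e \<in> E" using F_edge e by auto
  \<comment> \<open>The chosen path differs from \<open>P\<close> only by assigned hyperedges, while
    \<open>e\<close> is unassigned and not on \<open>P\<close>.\<close>
  have new: "e \<notin> set (es1 @ f # es2)" using eR e(2) Q es by auto
  have bp: "berge_path (xs @ rev ys, es1 @ e # rev es2)"
  proof (rule berge_path_rotate)
    show "berge_path (xs @ ys, es1 @ f # es2)" using Q Qeq by simp
    show "berge_step R (last xs) e (last ys)" using free_stepI[OF eR] e v lys by auto
  qed (use es v eE new in auto)
  show ?thesis
  proof (rule that)
    show "longest_path (xs @ rev ys, es1 @ e # rev es2)"
      using bp assms(1) Q v by (auto simp: longest_path_def)
    show "last (fst (xs @ rev ys, es1 @ e # rev es2)) = t" using v by (simp add: last_rev)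
    show "hd (fst (xs @ rev ys, es1 @ e # rev es2)) = hd (fst P)" using v Q by auto
    show "t \<noteq> hd (fst P)"
      using v Q unfolding berge_path_def by (cases xs; cases ys) auto
    show "set (fst (xs @ rev ys, es1 @ e # rev es2)) = set (fst P)" using v Q by auto
    show "set (snd (xs @ rev ys, es1 @ e # rev es2)) \<subseteq> set (snd P) \<union> snd ` R \<union> F"
      using es Q e by auto
  qed
qed

text \<open>The cycle closed by \<open>g\<close> is cut just after \<open>u\<close>. The resulting
  path has the same vertices and ends in \<open>u\<close>, so \<open>e\<close> prolongs it to
  \<open>x\<close>, against maximality. If \<open>u\<close> is already the last vertex,
  \<open>e\<close> prolongs the path directly.\<close>

lemma closable_path_spanning:
  assumes "longest_path (vs, es)" "g \<in> E" "g \<notin> set es" "berge_step R (last vs) g (hd vs)"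
    and "u \<in> set vs" "x \<notin> set vs" "e \<in> E" "e \<notin> set es" "e \<noteq> g" "berge_step R u e x"
  shows False
proof -
  have P: "berge_path (vs, es)" using assms(1) by (simp add: longest_path_def)
  obtain xs ys where vs: "vs = (xs @ [u]) @ ys" using split_list[OF assms(5)] by auto
  show False
  proof (cases "ys = []")
    case True
    then show False using longest_path_closed[OF assms(1), of e x] assms vs by auto
  next
    case False
    have "linked (berge_step R) ((xs @ [u]) @ ys) es" using P vs by (simp add: berge_path_def)
    then obtain es1 f es2 where es: "es = es1 @ f # es2" "linked (berge_step R) (xs @ [u]) es1"
      "linked (berge_step R) ys es2"
      using linked_splitE[of "berge_step R" "xs @ [u]" ys es] False by blast
    have "linked (berge_step R) (ys @ (xs @ [u])) (es2 @ g # es1)"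
      using es assms(4) vs False linked_length[OF es(3)]
      by (subst linked_append) (auto simp: hd_append)
    then have "berge_path (ys @ (xs @ [u]), es2 @ g # es1)"
      using P vs es assms(2,3) unfolding berge_path_def by auto
    then have "berge_path ((ys @ (xs @ [u])) @ [x], (es2 @ g # es1) @ [e])"
      using assms vs es by (intro berge_path_extend) auto
    then show False using assms(1) vs unfolding longest_path_def by fastforce
  qed
qed

end

text \<open>Each escape property negates a confinement to half of the vertices.
  \<open>rotate_F\<close> makes more than half of the vertices new ends, \<open>close_G\<close>
  joins the two ends of a path, and \<open>leave_F\<close> treats a large set of vertices missed by
  the path; there \<open>B\<close> will hold the hyperedges of the path and the closing one.\<close>

locale berge_closing = berge_expander +
  assumes FG: "F \<inter> G = {}"
    and rotate_F: "\<And>P T. berge_path P \<Longrightarrow> T \<subseteq> V \<Longrightarrow> m < card (endpoints R P) \<Longrightarrow>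
      \<forall>s\<in>endpoints R P. card (pivots R P T s) \<le> card V div 2 \<Longrightarrow>
      \<exists>s\<in>endpoints R P. \<exists>e\<in>F - set (snd P). s \<in> e \<and> \<not> e \<subseteq> insert s (pivots R P T s)"
    and leave_F: "\<And>W B. W \<subseteq> V \<Longrightarrow> m < card W \<Longrightarrow> card W \<le> card V div 2 \<Longrightarrow> B \<subseteq> E \<Longrightarrow>
      card B \<le> card V \<Longrightarrow> \<exists>w\<in>W. \<exists>e\<in>F - B. w \<in> e \<and> \<not> e \<subseteq> W"
    and close_G: "\<And>P. berge_path P \<Longrightarrow> m < card (endpoints R P) \<Longrightarrow>
      \<forall>a\<in>endpoints R P. card (V - other_ends R P F a) \<le> card V div 2 \<Longrightarrow>
      \<exists>a\<in>endpoints R P. \<exists>e\<in>G - set (snd P). a \<in> e \<and> \<not> e \<subseteq> insert a (V - other_ends R P F a)"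
begin

lemma new_ends_subset:
  assumes "longest_path P"
  shows "new_ends R P F \<subseteq> V"
proof
  fix t assume t: "t \<in> new_ends R P F"
  obtain Q where "longest_path Q" "last (fst Q) = t" using new_endsE[OF assms t] .
  then show "t \<in> V"
    unfolding longest_path_def berge_path_def by (cases "fst Q") (auto split: if_splits)
qed

text \<open>With too few new ends, the pivots for the set of all new ends are few as well, and some
  hyperedge at an end \<open>s\<close> contains a vertex \<open>u\<close> outside them. By
  maximality \<open>u\<close> lies on the path, so its successor is a new end and \<open>u\<close>
  is a pivot after all.\<close>

lemma many_new_ends:
  assumes "longest_path P"
  shows "card V div 2 < card (new_ends R P F)"
proof (rule ccontr)
  let ?T = "new_ends R P F"
  assume *: "\<not> card V div 2 < card ?T"
  have P: "berge_path P" using assms by (simp add: longest_path_def)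
  have "card (pivots R P ?T s) \<le> card V div 2" if "s \<in> endpoints R P" for s
  proof -
    have "distinct (fst (path_to R P s))"
      using path_to[OF that] rotations_berge_path[OF _ P] by (auto simp: berge_path_def)
    moreover have "finite ?T" using new_ends_subset[OF assms] finite_V finite_subset by auto
    ultimately show ?thesis using card_pivots[of R P s ?T] * by simp
  qed
  then obtain s e where s: "s \<in> endpoints R P" and e: "e \<in> F" "e \<notin> set (snd P)" "s \<in> e"
    "\<not> e \<subseteq> insert s (pivots R P ?T s)"
    using rotate_F[OF P new_ends_subset[OF assms] many_endpoints[OF assms]] by auto
  then obtain u where u: "u \<in> e" "u \<noteq> s" "u \<notin> pivots R P ?T s" by auto
  let ?Q = "path_to R P s"
  have rot: "rotations R P ?Q" and l: "last (fst ?Q) = s" using path_to[OF s] by auto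
  have mx: "longest_path ?Q" using longest_path_rotations[OF rot assms] .
  have eR: "e \<notin> snd ` R" "e \<in> E" using F_edge e by auto
  have "u \<in> set (fst ?Q)"
    using longest_path_closed[OF mx eR(2), of u] eR e u free_stepI[of e s u] l rotations_berge_path[OF rot P]
    by auto
  then obtain t where t: "(u, t) \<in> succs (fst ?Q)" using succs_exists[of u "fst ?Q"] u l by metis
  then have "t \<in> ?T" unfolding new_ends_def using s e u by blast
  then show False using u(3) t unfolding pivots_def by blast
qed

theorem hamilton_cycle:
  "\<exists>vs es. vs \<noteq> [] \<and> length es = length vs \<and> distinct vs \<and> set vs = V \<and>
     distinct es \<and> set es \<subseteq> E \<and> {hd vs, last vs} \<subseteq> last es \<and>
     (\<forall>i. Suc i < length vs \<longrightarrow> {vs ! i, vs ! Suc i} \<subseteq> es ! i)"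
proof -
  obtain P where P: "longest_path P" using longest_path_exists by auto
  then have bP: "berge_path P" by (simp add: longest_path_def)
  define start where "start = (\<lambda>a. reverse_path (path_to R P a))"
  have start: "longest_path (start a)" "hd (fst (start a)) = a"
    "set (snd (start a)) \<subseteq> set (snd P) \<union> snd ` R" if a: "a \<in> endpoints R P" for a
  proof -
    have rot: "rotations R P (path_to R P a)" and l: "last (fst (path_to R P a)) = a"
      using path_to[OF a] by auto
    show "longest_path (start a)"
      unfolding start_def using longest_path_reverse longest_path_rotations[OF rot P] by blast
    show "hd (fst (start a)) = a" using l by (simp add: start_def reverse_path_def hd_rev)
    show "set (snd (start a)) \<subseteq> set (snd P) \<union> snd ` R"
      using rotations_berge_path[OF rot bP] by (simp add: start_def reverse_path_def)
  qed
  have oe: "other_ends R P F a = new_ends R (start a) F" for a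
    by (simp add: other_ends_def start_def)
  \<comment> \<open>More than half of the vertices are possible opposite ends for \<open>a\<close>,
    so the complement qualifies as a confining set.\<close>
  have "card (V - other_ends R P F a) \<le> card V div 2" if "a \<in> endpoints R P" for a
    using many_new_ends[OF start(1)[OF that]] new_ends_subset[OF start(1)[OF that]] finite_V
    by (simp add: oe card_Diff_subset finite_subset)
  then obtain a g where a: "a \<in> endpoints R P" and g: "g \<in> G" "g \<notin> set (snd P)" "a \<in> g"
    "\<not> g \<subseteq> insert a (V - other_ends R P F a)"
    using close_G[OF bP many_endpoints[OF P]] by auto
  have gE: "g \<in> E" "g \<notin> snd ` R" using g(1) G_edge by auto
  then have "g \<subseteq> V" using edges by auto
  then obtain t where t: "t \<in> g" "t \<noteq> a" "t \<in> new_ends R (start a) F" using g(4) oe by auto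
  obtain Q where Q: "longest_path Q" "last (fst Q) = t" "hd (fst Q) = hd (fst (start a))"
    "set (fst Q) = set (fst (start a))" "set (snd Q) \<subseteq> set (snd (start a)) \<union> snd ` R \<union> F"
    using new_endsE[OF start(1)[OF a] t(3)] by metis
  obtain vs es where Qeq: "Q = (vs, es)" by (cases Q)
  have hd_vs: "hd vs = a" and last_vs: "last vs = t" using Q start(2)[OF a] Qeq by auto
  \<comment> \<open>The hyperedges of \<open>Q\<close> are assigned, or in \<open>F\<close>, or on
    \<open>P\<close>. The class \<open>G\<close> is disjoint from the first two kinds, and
    \<open>g\<close> was chosen off \<open>P\<close>.\<close>
  have g_new: "g \<notin> set es" using Q(5) start(3)[OF a] g(1,2) gE(2) FG Qeq by auto
  have bQ: "berge_path (vs, es)" using Q(1) Qeq by (simp add: longest_path_def)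
  have len: "length vs = Suc (length es)" and link: "linked (berge_step R) vs es"
    using bQ linked_length by (auto simp: berge_path_def)
  have closed: "berge_step R (last vs) g (hd vs)"
    using free_stepI[OF gE(2)] t g hd_vs last_vs by auto
  have spanning: False if x: "x \<in> V - set vs" and u: "u \<in> set vs"
    and e: "e \<in> E" "e \<notin> set es" "e \<noteq> g" "berge_step R u e x" for x u e
    using closable_path_spanning[OF Q(1)[unfolded Qeq] gE(1) g_new closed u _ e] x by auto
  have "V \<subseteq> set vs"
  proof (rule ccontr)
    assume not: "\<not> V \<subseteq> set vs"
    define W where "W = V - set vs"
    have W: "W \<subseteq> V" "W \<noteq> {}" using not by (auto simp: W_def)
    have finW: "finite W" using W finite_V finite_subset by auto
    have inV: "set vs \<subseteq> V" using bQ by (simp add: berge_path_def)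
    show False
    \<comment> \<open>A small set of missed vertices is left by an assigned hyperedge because of
      \<open>few_inside\<close>. A larger one has more than \<open>m\<close> and at most half of the
      vertices, the range covered by \<open>leave_F\<close>.\<close>
    proof (cases "card W \<le> 3 * m")
      case True
      have "\<exists>x\<in>W. \<exists>e. (x, e) \<in> R \<and> \<not> e \<subseteq> W"
      proof (rule ccontr)
        assume "\<not> ?thesis"
        then have sub: "(\<Union>x\<in>W. {e. (x, e) \<in> R}) \<subseteq> {e \<in> snd ` R. e \<subseteq> W}" by force
        have "(k - 1) * card W \<le> (\<Sum>x\<in>W. k)" by simp
        also have "\<dots> \<le> (\<Sum>x\<in>W. card {e. (x, e) \<in> R})"
          using W R_degree by (intro sum_mono) auto
        also have "\<dots> = card (\<Union>x\<in>W. {e. (x, e) \<in> R})"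
          using R_unique finite_R_at finW by (intro card_UN_disjoint[symmetric]) auto
        also have "\<dots> \<le> card {e \<in> snd ` R. e \<subseteq> W}"
          using sub finite_R by (intro card_mono) auto
        finally show False using few_inside[OF W True] by simp
      qed
      then obtain x e u where x: "x \<in> W" "(x, e) \<in> R" "u \<in> e" "u \<notin> W" by auto
      have eE: "e \<in> E" "e \<subseteq> V" using R_edge[OF x(2)] edges by auto
      \<comment> \<open>A step of the path through \<open>e\<close> would have to visit
        \<open>x\<close>, the vertex to which \<open>e\<close> is assigned.\<close>
      have "e \<notin> set es"
      proof
        assume "e \<in> set es"
        then obtain v w where "v \<in> set vs" "w \<in> set vs" "berge_step R v e w"
          using linked_edge_ends[OF link] by metis
        then show False using x by (auto simp: berge_step_def W_def)
      qed
      moreover have "e \<noteq> g" using x(2) gE(2) by force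
      ultimately show False
        using spanning[of x u e] x eE R_stepI[OF x(2,3)] by (auto simp: W_def)
    next
      case False
      have "card W = card V - length vs"
        using inV bQ finite_V by (simp add: W_def card_Diff_subset distinct_card berge_path_def)
      moreover have "card V div 2 < length vs"
      proof -
        have "new_ends R (start a) F \<subseteq> set vs"
        proof
          fix t assume t: "t \<in> new_ends R (start a) F"
          obtain Q' where "longest_path Q'" "last (fst Q') = t" "set (fst Q') = set (fst (start a))"
            using new_endsE[OF start(1)[OF a] t] by metis
          then show "t \<in> set vs" using Q(4) Qeq
            unfolding longest_path_def berge_path_def
            by (metis fst_conv last_in_set linked.simps(1))
        qed
        then have "card (new_ends R (start a) F) \<le> length vs"
          by (meson List.finite_set card_length card_mono le_trans)
        then show ?thesis using many_new_ends[OF start(1)[OF a]] by simp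
      qed
      ultimately have "card W \<le> card V div 2" by simp
      \<comment> \<open>\<open>es\<close> has one entry less than \<open>vs\<close>, which leaves
        room for \<open>g\<close>.\<close>
      moreover have "card (insert g (set es)) \<le> card V"
      proof -
        have "card (insert g (set es)) \<le> Suc (length es)"
          by (metis card_insert_le_m1 card_length diff_Suc_1 zero_less_Suc)
        also have "\<dots> \<le> card V"
          using len inV bQ finite_V by (metis berge_path_def card_mono distinct_card fst_conv)
        finally show ?thesis .
      qed
      moreover have "insert g (set es) \<subseteq> E" using gE bQ by (auto simp: berge_path_def)
      ultimately obtain w e u where w: "w \<in> W" "e \<in> F" "e \<notin> insert g (set es)" "w \<in> e" "u \<in> e" "u \<notin> W"
        using leave_F[of W "insert g (set es)"] W(1) False by fastforce
      have "e \<in> E" "e \<notin> snd ` R" using w F_edge by auto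
      then show False
        using spanning[of w u e] w free_stepI[of e u w] edges[of e] by (auto simp: W_def)
    qed
  qed
  then have "set vs = V" using bQ by (auto simp: berge_path_def)
  moreover have "{vs ! i, vs ! Suc i} \<subseteq> (es @ [g]) ! i" if "Suc i < length vs" for i
    using linked_nth[OF link that] that len by (simp add: nth_append berge_step_def)
  ultimately show ?thesis
    using bQ len gE g_new g t hd_vs last_vs
    by (intro exI[of _ vs] exI[of _ "es @ [g]"]) (auto simp: berge_path_def)
qed

end

section \<open>Tail bounds\<close>

lemma Pi_pmf_exp_markov:
  fixes f :: "'a \<Rightarrow> 'b \<Rightarrow> real"
  assumes A: "finite A" and fin: "\<And>x. x \<in> A \<Longrightarrow> finite (set_pmf (p x))"
  shows "measure_pmf.prob (Pi_pmf A d p) {\<omega>. t \<le> (\<Sum>x\<in>A. f x (\<omega> x))}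
    \<le> exp (- t) * (\<Prod>x\<in>A. measure_pmf.expectation (p x) (\<lambda>v. exp (f x v)))"
proof -
  let ?M = "Pi_pmf A d p"
  have finM: "finite (set_pmf ?M)"
    using A fin by (auto simp: set_Pi_pmf intro!: finite_PiE_dflt)
  have eq: "exp (\<Sum>x\<in>A. f x (\<omega> x)) = (\<Prod>x\<in>A. exp (f x (\<omega> x)))" for \<omega>
    using A by (rule exp_sum)
  have "measure_pmf.prob ?M {\<omega>. t \<le> (\<Sum>x\<in>A. f x (\<omega> x))}
      = measure_pmf.prob ?M {\<omega> \<in> space ?M. exp t \<le> (\<Prod>x\<in>A. exp (f x (\<omega> x)))}"
    by (simp flip: eq)
  also have "\<dots> \<le> measure_pmf.expectation ?M (\<lambda>\<omega>. \<Prod>x\<in>A. exp (f x (\<omega> x))) / exp t"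
    by (rule integral_Markov_inequality_measure[where A = UNIV])
      (auto intro!: integrable_measure_pmf_finite finM prod_nonneg)
  also have "measure_pmf.expectation ?M (\<lambda>\<omega>. \<Prod>x\<in>A. exp (f x (\<omega> x)))
     = (\<Prod>x\<in>A. measure_pmf.expectation (p x) (\<lambda>v. exp (f x v)))"
    using A fin by (intro expectation_prod_Pi_pmf) (auto intro: integrable_measure_pmf_finite)
  finally show ?thesis by (simp add: exp_minus field_simps)
qed

lemma prob_pair_pmf:
  "measure_pmf.prob (pair_pmf M N) S
     = measure_pmf.expectation M (\<lambda>x. measure_pmf.prob N {y. (x, y) \<in> S})"
proof -
  have "emeasure (pair_pmf M N) S = (\<integral>\<^sup>+x. emeasure N {y. (x, y) \<in> S} \<partial>M)"
    using nn_integral_pair_pmf'[of M N "indicator S"]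
    by (simp add: indicator_def flip: nn_integral_indicator)
  also have "\<dots> = (\<integral>\<^sup>+x. ennreal (measure_pmf.prob N {y. (x, y) \<in> S}) \<partial>M)"
    by (simp add: measure_pmf.emeasure_eq_measure)
  also have "\<dots> = ennreal (measure_pmf.expectation M (\<lambda>x. measure_pmf.prob N {y. (x, y) \<in> S}))"
    by (intro nn_integral_eq_integral measure_pmf.integrable_const_bound[where B = 1]) auto
  finally show ?thesis by (simp add: measure_pmf.emeasure_eq_measure)
qed

lemma expectation_exp_event:
  fixes w :: real
  assumes "finite (set_pmf M)"
  shows "measure_pmf.expectation M (\<lambda>v. exp (if v \<in> K then w else 0))
     = 1 + measure_pmf.prob M K * (exp w - 1)"
proof -
  have "measure_pmf.expectation M (\<lambda>v. exp (if v \<in> K then w else 0))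
     = measure_pmf.expectation M (\<lambda>v. 1 + indicator K v * (exp w - 1))"
    by (intro Bochner_Integration.integral_cong) (auto simp: indicator_def)
  also have "\<dots> = 1 + measure_pmf.prob M K * (exp w - 1)"
    by (subst Bochner_Integration.integral_add) (auto intro: integrable_measure_pmf_finite assms)
  finally show ?thesis .
qed

lemma prod_one_plus_le_exp:
  fixes a :: "'a \<Rightarrow> real"
  assumes "\<And>x. x \<in> A \<Longrightarrow> - 1 \<le> a x"
  shows "(\<Prod>x\<in>A. 1 + a x) \<le> exp (\<Sum>x\<in>A. a x)"
proof (cases "finite A")
  case True
  have "(\<Prod>x\<in>A. 1 + a x) \<le> (\<Prod>x\<in>A. exp (a x))"
    using assms exp_ge_add_one_self by (intro prod_mono) (smt (verit))
  then show ?thesis using True by (simp add: exp_sum)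
qed auto

text \<open>Coins and colours stay separate factors so that the colours alone can be averaged for a
  fixed outcome of the coins and a subgraph chosen from it.\<close>

abbreviation coloured_coins ::
  "'a set \<Rightarrow> real \<Rightarrow> nat pmf \<Rightarrow> (('a \<Rightarrow> bool) \<times> ('a \<Rightarrow> nat)) pmf" where
  "coloured_coins U p col \<equiv>
     pair_pmf (Pi_pmf U False (\<lambda>_. bernoulli_pmf p)) (Pi_pmf U 0 (\<lambda>_. col))"

text \<open>Averaging over the colours with the coins fixed leaves a product over hyperedges.
  Averaging this over the coins gives the factors \<open>1 + p * q * (exp (w e) - 1)\<close>, where
  \<open>q\<close> is the probability of \<open>K\<close>, and each is at most an
  exponential.\<close>

lemma coloured_coins_upper_tail:
  fixes w :: "'a \<Rightarrow> real"
  assumes U: "finite U" and p: "0 \<le> p" "p \<le> 1" and col: "finite (set_pmf col)"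
    and w: "\<And>e. e \<in> U \<Longrightarrow> 0 \<le> w e"
  shows "measure_pmf.prob (coloured_coins U p col)
      {(x, c). t \<le> (\<Sum>e\<in>{e \<in> U. x e \<and> c e \<in> K}. w e)}
    \<le> exp (- t + p * measure_pmf.prob col K * (\<Sum>e\<in>U. exp (w e) - 1))"
proof -
  let ?X = "Pi_pmf U False (\<lambda>_. bernoulli_pmf p)"
  let ?C = "Pi_pmf U 0 (\<lambda>_. col)"
  define q where "q = measure_pmf.prob col K"
  have q: "0 \<le> q" by (simp add: q_def)
  define g where "g = (\<lambda>e b. 1 + (if b then q * (exp (w e) - 1) else 0))"
  have g1: "1 \<le> g e b" if "e \<in> U" for e b using q w[OF that] by (simp add: g_def)
  have finX: "finite (set_pmf ?X)"
    using U by (auto simp: set_Pi_pmf intro!: finite_PiE_dflt)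
  have *: "measure_pmf.prob ?C {c. t \<le> (\<Sum>e\<in>{e \<in> U. x e \<and> c e \<in> K}. w e)}
      \<le> exp (- t) * (\<Prod>e\<in>U. g e (x e))" for x
  proof -
    have "(\<Sum>e\<in>{e \<in> U. x e \<and> c e \<in> K}. w e)
        = (\<Sum>e\<in>U. if c e \<in> K then (if x e then w e else 0) else 0)" for c
      using U by (subst sum.inter_filter) (auto intro!: sum.cong)
    then have "measure_pmf.prob ?C {c. t \<le> (\<Sum>e\<in>{e \<in> U. x e \<and> c e \<in> K}. w e)}
      \<le> exp (- t) * (\<Prod>e\<in>U. measure_pmf.expectation col
          (\<lambda>v. exp (if v \<in> K then (if x e then w e else 0) else 0)))"
      using Pi_pmf_exp_markov[OF U, of "\<lambda>_. col" 0 t "\<lambda>e v. if v \<in> K then (if x e then w e else 0) else 0"] col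
      by simp
    also have "\<dots> = exp (- t) * (\<Prod>e\<in>U. g e (x e))"
      unfolding expectation_exp_event[OF col]
      by (intro arg_cong2[where f = "(*)"] prod.cong) (auto simp: g_def q_def)
    finally show ?thesis .
  qed
  have "measure_pmf.prob (coloured_coins U p col)
      {(x, c). t \<le> (\<Sum>e\<in>{e \<in> U. x e \<and> c e \<in> K}. w e)}
    = measure_pmf.expectation ?X (\<lambda>x. measure_pmf.prob ?C {c. t \<le> (\<Sum>e\<in>{e \<in> U. x e \<and> c e \<in> K}. w e)})"
    by (subst prob_pair_pmf) simp
  also have "\<dots> \<le> measure_pmf.expectation ?X (\<lambda>x. exp (- t) * (\<Prod>e\<in>U. g e (x e)))"
    by (intro integral_mono integrable_measure_pmf_finite finX *)
  also have "\<dots> = exp (- t) * (\<Prod>e\<in>U. measure_pmf.expectation (bernoulli_pmf p) (g e))"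
    using U g1 by (subst expectation_prod_Pi_pmf[symmetric])
      (auto intro!: integrable_measure_pmf_finite intro: order_trans[OF zero_le_one])
  also have "(\<Prod>e\<in>U. measure_pmf.expectation (bernoulli_pmf p) (g e))
     = (\<Prod>e\<in>U. 1 + p * q * (exp (w e) - 1))"
    using p by (intro prod.cong) (auto simp: g_def algebra_simps)
  also have "\<dots> \<le> exp (\<Sum>e\<in>U. p * q * (exp (w e) - 1))"
    using p q w by (intro prod_one_plus_le_exp) (auto intro: order_trans[of _ 0])
  also have "exp (- t) * exp (\<Sum>e\<in>U. p * q * (exp (w e) - 1))
      = exp (- t + p * measure_pmf.prob col K * (\<Sum>e\<in>U. exp (w e) - 1))"
    unfolding q_def sum_distrib_left exp_add[symmetric] by simp
  finally show ?thesis by simp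
qed

text \<open>\<open>K\<close> may vary with the hyperedge because the colour that assigns
  \<open>e\<close> to a given vertex depends on the rank of the vertex in \<open>e\<close>; only the
  probability \<open>q\<close> is common.\<close>

lemma colours_lower_tail:
  fixes \<mu> \<delta> :: real
  assumes U: "finite U" and col: "finite (set_pmf col)" and S: "S \<subseteq> U"
    and q: "\<And>e. e \<in> S \<Longrightarrow> measure_pmf.prob col (K e) = q" and \<mu>: "\<mu> \<le> real (card S) * q"
    and \<delta>: "0 \<le> \<delta>" "0 \<le> \<mu>"
  shows "measure_pmf.prob (Pi_pmf U 0 (\<lambda>_. col))
      {c. real (card {e \<in> S. c e \<in> K e}) \<le> (1 - \<delta>) * \<mu>} \<le> exp (- (\<delta>\<^sup>2 * \<mu> / 4))"
proof -
  \<comment> \<open>This choice minimises the final exponent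
    \<open>\<mu> * (l^2 - l * \<delta>)\<close>.\<close>
  define l where "l = \<delta> / 2"
  have l: "0 \<le> l" using \<delta> by (simp add: l_def)
  have finS: "finite S" using U S finite_subset by blast
  let ?f = "\<lambda>e v. if v \<in> (if e \<in> S then K e else {}) then - l else 0"
  have sum_eq: "(\<Sum>e\<in>U. ?f e (c e)) = - l * real (card {e \<in> S. c e \<in> K e})" for c
  proof -
    have "(\<Sum>e\<in>U. ?f e (c e)) = (\<Sum>e\<in>{e \<in> U. e \<in> S \<and> c e \<in> K e}. - l)"
      by (subst sum.inter_filter[OF U]) (auto intro!: sum.cong)
    also have "{e \<in> U. e \<in> S \<and> c e \<in> K e} = {e \<in> S. c e \<in> K e}" using S by auto
    finally show ?thesis by simp
  qed
  have e1: "exp (- l) - 1 \<le> - l + l\<^sup>2"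
  proof -
    have "exp (- l) \<le> 1 / (1 + l)"
      using exp_ge_add_one_self[of l] l by (simp add: exp_minus field_simps)
    also have "\<dots> \<le> 1 - l + l\<^sup>2"
      using l by (simp add: field_simps power2_eq_square)
    finally show ?thesis by simp
  qed
  have "{c. real (card {e \<in> S. c e \<in> K e}) \<le> (1 - \<delta>) * \<mu>} \<subseteq> {c. - l * ((1 - \<delta>) * \<mu>) \<le> (\<Sum>e\<in>U. ?f e (c e))}"
    unfolding sum_eq using l by (auto intro: mult_left_mono)
  then have "measure_pmf.prob (Pi_pmf U 0 (\<lambda>_. col)) {c. real (card {e \<in> S. c e \<in> K e}) \<le> (1 - \<delta>) * \<mu>}
     \<le> measure_pmf.prob (Pi_pmf U 0 (\<lambda>_. col)) {c. - l * ((1 - \<delta>) * \<mu>) \<le> (\<Sum>e\<in>U. ?f e (c e))}"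
    by (intro measure_pmf.finite_measure_mono) auto
  also have "\<dots> \<le> exp (l * ((1 - \<delta>) * \<mu>)) * (\<Prod>e\<in>U. measure_pmf.expectation col (\<lambda>v. exp (?f e v)))"
    using Pi_pmf_exp_markov[OF U, of "\<lambda>_. col" 0 "- l * ((1 - \<delta>) * \<mu>)" ?f] col by simp
  also have "(\<Prod>e\<in>U. measure_pmf.expectation col (\<lambda>v. exp (?f e v)))
     = (\<Prod>e\<in>U. 1 + (if e \<in> S then q else 0) * (exp (- l) - 1))"
    unfolding expectation_exp_event[OF col] by (intro prod.cong) (auto simp: q)
  also have "\<dots> \<le> exp (\<Sum>e\<in>U. (if e \<in> S then q else 0) * (exp (- l) - 1))"
  proof (rule prod_one_plus_le_exp)
    fix e assume "e \<in> U"
    have "e \<in> S \<Longrightarrow> 0 \<le> q \<and> q \<le> 1" using q[of e] measure_pmf.prob_le_1[of col "K e"] by auto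
    moreover have "q * (1 - exp (- l)) \<le> 1 * 1" if "0 \<le> q" "q \<le> 1"
      using that l by (intro mult_mono) auto
    ultimately show "- 1 \<le> (if e \<in> S then q else 0) * (exp (- l) - 1)"
      by (auto simp: algebra_simps)
  qed
  also have "(\<Sum>e\<in>U. (if e \<in> S then q else 0) * (exp (- l) - 1)) = real (card S) * q * (exp (- l) - 1)"
    using U Int_absorb1[OF S] by (simp add: sum.If_cases flip: sum_distrib_right)
  also have "exp (l * ((1 - \<delta>) * \<mu>)) * exp (real (card S) * q * (exp (- l) - 1))
     \<le> exp (l * ((1 - \<delta>) * \<mu>)) * exp (\<mu> * (exp (- l) - 1))"
    using \<mu> l by (intro mult_left_mono) (auto intro: mult_right_mono_neg)
  also have "\<dots> \<le> exp (l * ((1 - \<delta>) * \<mu>)) * exp (\<mu> * (- l + l\<^sup>2))"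
    using e1 \<delta> by (intro mult_left_mono) (auto intro: mult_left_mono)
  also have "\<dots> = exp (- (\<delta>\<^sup>2 * \<mu> / 4))"
    unfolding exp_add[symmetric] by (simp add: l_def power2_eq_square field_simps)
  finally show ?thesis by (simp add: mult_left_mono)
qed

section \<open>Edges of a colour class\<close>

lemma Suc_times_choose_Suc: "Suc j * (m choose Suc j) = (m - j) * (m choose j)"
  using binomial_absorb_comp[of m j] binomial_absorption[of j m] by simp

text \<open>The quotient of the two binomial coefficients is a product of factors (m - i) / (n - i),
  each at most m / n; the form without division needs no separate treatment of zero
  denominators.\<close>

lemma choose_ratio_le:
  assumes "m \<le> n"
  shows "real (m choose j) * real n ^ j \<le> real m ^ j * real (n choose j)"
proof (induction j)
  case (Suc j)
  have *: "real (Suc j) * real (a choose Suc j) = real (a - j) * real (a choose j)" for a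
    using Suc_times_choose_Suc[of j a] by (metis of_nat_mult)
  have "(m - j) * n \<le> m * (n - j)"
    using diff_le_mono2[OF mult_le_mono2[OF assms], of "m * n" j]
    unfolding diff_mult_distrib diff_mult_distrib2 mult.commute[of m j] .
  then have le: "real (m - j) * real n \<le> real m * real (n - j)"
    by (metis of_nat_le_iff of_nat_mult)
  have "real (Suc j) * (real (m choose Suc j) * real n ^ Suc j)
      = (real (Suc j) * real (m choose Suc j)) * real n ^ Suc j"
    by (rule mult.assoc[symmetric])
  also have "\<dots> = (real (m choose j) * real n ^ j) * (real (m - j) * real n)"
    unfolding * by simp
  also have "\<dots> \<le> (real m ^ j * real (n choose j)) * (real m * real (n - j))"
    by (rule mult_mono[OF Suc le]) auto
  also have "\<dots> = real m ^ Suc j * (real (Suc j) * real (n choose Suc j))"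
    unfolding * by simp
  also have "\<dots> = real (Suc j) * (real m ^ Suc j * real (n choose Suc j))"
    by (rule mult.left_commute)
  finally show ?case by (rule mult_left_le_imp_le) simp
qed simp

text \<open>With \<open>j = r - 1\<close> this is the source of the constant
  \<open>1 / 2 ^ (r - 1)\<close> in the degree condition.\<close>

lemma choose_half_le: "real ((n div 2) choose j) \<le> real (n choose j) / 2 ^ j"
proof (cases "n = 0")
  case True
  then show ?thesis by (cases j) auto
next
  case False
  have half: "real (n div 2) \<le> real n / 2" by linarith
  have "real ((n div 2) choose j) * real n ^ j \<le> real (n div 2) ^ j * real (n choose j)"
    by (rule choose_ratio_le) simp
  also have "\<dots> \<le> (real n / 2) ^ j * real (n choose j)"
    by (intro mult_right_mono power_mono) (use half in auto)
  finally show ?thesis using False by (simp add: power_divide field_simps)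
qed

lemma choose_Suc_le: "real (m choose Suc j) \<le> real m * real (m choose j)"
proof -
  have "Suc j * (m choose Suc j) \<le> m * (m choose j)"
    unfolding Suc_times_choose_Suc by (simp add: mult_le_mono1)
  then have "(m choose Suc j) \<le> m * (m choose j)"
    by (metis le_add1 le_trans mult_Suc)
  then show ?thesis by (metis of_nat_le_iff of_nat_mult)
qed

lemma finite_uniform_edges: "finite (uniform_edges r n)"
  unfolding uniform_edges_def by (rule finite_subset[of _ "Pow {1..n}"]) auto

lemma card_uniform_edges: "card (uniform_edges r n) = n choose r"
  using n_subsets[of "{1..n}" r] by (simp add: uniform_edges_def)

lemma card_edges_inside:
  assumes "Y \<subseteq> {1..n}"
  shows "card {e \<in> uniform_edges r n. e \<subseteq> Y} = card Y choose r"
proof -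
  have "{e \<in> uniform_edges r n. e \<subseteq> Y} = {e. e \<subseteq> Y \<and> card e = r}"
    using assms by (auto simp: uniform_edges_def)
  moreover have "finite Y" using assms finite_subset by blast
  ultimately show ?thesis by (simp add: n_subsets)
qed

lemma card_edges_at_inside:
  assumes "finite W" "r > 0"
  shows "card {e \<in> uniform_edges r n. a \<in> e \<and> e \<subseteq> insert a W} \<le> card W choose (r - 1)"
proof -
  let ?A = "{e \<in> uniform_edges r n. a \<in> e \<and> e \<subseteq> insert a W}"
  have "card ?A = card ((\<lambda>e. e - {a}) ` ?A)"
    by (rule card_image[symmetric]) (auto simp: inj_on_def)
  also have "\<dots> \<le> card {f. f \<subseteq> W \<and> card f = r - 1}"
  proof (rule card_mono)
    show "(\<lambda>e. e - {a}) ` ?A \<subseteq> {f. f \<subseteq> W \<and> card f = r - 1}"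
      by (auto simp: uniform_edges_def)
  qed (use assms in auto)
  also have "\<dots> = card W choose (r - 1)" using assms by (simp add: n_subsets)
  finally show ?thesis .
qed

text \<open>The sum over \<open>A\<close> is controlled instead of each vertex: a single degree of
  polylogarithmic size deviates with a probability far too large for a union bound over
  \<open>\<Phi>\<close>. The counts are monotone in \<open>F\<close>, so a bound for a random class
  passes to every subset chosen from it.\<close>

definition untrapped ::
  "nat \<Rightarrow> nat \<Rightarrow> nat \<Rightarrow> real \<Rightarrow> (nat set \<times> (nat \<Rightarrow> nat set)) set \<Rightarrow> nat set set \<Rightarrow> bool" where
  "untrapped n h m t \<Phi> F \<longleftrightarrow> (\<forall>(A, W)\<in>\<Phi>. A \<subseteq> {1..n} \<longrightarrow> m < card A \<longrightarrow>
     (\<forall>a\<in>A. finite (W a) \<and> card (W a) \<le> h) \<longrightarrow>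
     (\<Sum>a\<in>A. real (card {e \<in> F. a \<in> e \<and> e \<subseteq> insert a (W a)})) < real (card A) * t)"

definition colour_class :: "('a \<Rightarrow> bool) \<Rightarrow> ('a \<Rightarrow> nat) \<Rightarrow> 'a set \<Rightarrow> nat set \<Rightarrow> 'a set" where
  "colour_class x c U K = {e \<in> U. x e \<and> c e \<in> K}"

text \<open>Parameters of one colour class: \<open>D\<close> is the expected degree of a vertex in it.\<close>

locale colour_class_model =
  fixes r n :: nat and p :: real and col :: "nat pmf" and K :: "nat set" and D :: real
  assumes r: "r > 0" and p: "0 \<le> p" "p \<le> 1" and finite_col: "finite (set_pmf col)"
    and D: "p * measure_pmf.prob col K * real (n choose (r - 1)) = D"
begin

abbreviation "U \<equiv> uniform_edges r n"
abbreviation "M \<equiv> coloured_coins U p col"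
abbreviation "cls x c \<equiv> colour_class x c U K"

lemma D_nonneg: "0 \<le> D" using D p by (metis measure_nonneg mult_nonneg_nonneg of_nat_0_le_iff)

lemma upper_tail:
  assumes "\<And>e. e \<in> U \<Longrightarrow> 0 \<le> w e"
  shows "measure_pmf.prob M {(x, c). t \<le> (\<Sum>e\<in>cls x c. w e)}
    \<le> exp (- t + p * measure_pmf.prob col K * (\<Sum>e\<in>U. exp (w e) - 1))"
  unfolding colour_class_def
  by (rule coloured_coins_upper_tail[OF finite_uniform_edges p finite_col assms])

lemma exp_minus_one_le: "exp 1 - 1 \<le> (2 :: real)"
  using exp_le by simp

text \<open>The mean is at most \<open>real n * D\<close> and \<open>exp 1 - 1\<close> is at most 2,
  so the exponent is at most (2 - 4) n D.\<close>

lemma many_edges: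
  "measure_pmf.prob M {(x, c). 4 * real n * D \<le> real (card (cls x c))} \<le> exp (- (real n * D))"
proof -
  have "measure_pmf.prob M {(x, c). 4 * real n * D \<le> real (card (cls x c))}
      \<le> exp (- (4 * real n * D) + p * measure_pmf.prob col K * (\<Sum>e\<in>U. exp 1 - 1))"
    using upper_tail[of "\<lambda>_. 1" "4 * real n * D"] by simp
  also have "\<dots> \<le> exp (- (real n * D))"
  proof -
    have "real (n choose r) \<le> real n * real (n choose (r - 1))"
      using choose_Suc_le[of n "r - 1"] r by simp
    then have "(p * measure_pmf.prob col K) * ((exp 1 - 1) * real (card U))
       \<le> (p * measure_pmf.prob col K) * (2 * (real n * real (n choose (r - 1))))"
      using p exp_minus_one_le by (intro mult_left_mono mult_mono) (auto simp: card_uniform_edges)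
    also have "\<dots> = 2 * real n * D" by (simp flip: D)
    finally have "p * measure_pmf.prob col K * (\<Sum>e\<in>U. exp 1 - 1) \<le> 2 * (real n * D)"
      by (simp add: mult_ac)
    moreover have "0 \<le> real n * D" using D_nonneg by simp
    ultimately show ?thesis unfolding exp_le_cancel_iff by linarith
  qed
  finally show ?thesis .
qed

text \<open>The mean number of hyperedges inside \<open>Y\<close> is at most
  \<open>\<epsilon> * D * card Y\<close>, since at most an \<epsilon>-fraction of all (r - 1)-sets
  lies in \<open>Y\<close>. The condition on \<open>t\<close> keeps the moment term below half of
  \<open>t * card Y\<close>.\<close>

lemma many_inside:
  assumes Y: "Y \<subseteq> {1..n}" "Y \<noteq> {}" and r3: "r \<ge> 3"
    and \<epsilon>: "real (card Y) \<le> \<epsilon> * real n" "\<epsilon> \<le> 1" and t: "4 * \<epsilon> * D \<le> t"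
  shows "measure_pmf.prob M {(x, c). t * real (card Y) \<le> real (card {e \<in> cls x c. e \<subseteq> Y})}
    \<le> exp (- (t * real (card Y) / 2))"
proof -
  define y where "y = real (card Y)"
  have y: "0 < y" using Y finite_subset[of Y "{1..n}"] by (auto simp: y_def card_gt_0_iff)
  have n: "0 < real n" using Y by (cases n) auto
  have eps: "0 < \<epsilon>" using y n \<epsilon>(1) unfolding y_def[symmetric] by (metis less_le_trans zero_less_mult_pos2)
  have ratio: "real (card Y choose (r - 1)) \<le> \<epsilon> * real (n choose (r - 1))"
  proof -
    have "card Y \<le> n" using card_mono[OF _ Y(1)] by simp
    then have "real (card Y choose (r - 1)) * real n ^ (r - 1) \<le> y ^ (r - 1) * real (n choose (r - 1))"
      unfolding y_def by (rule choose_ratio_le)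
    also have "\<dots> \<le> (\<epsilon> * real n) ^ (r - 1) * real (n choose (r - 1))"
      using \<epsilon> by (intro mult_right_mono power_mono) (auto simp: y_def)
    also have "\<dots> \<le> (\<epsilon> * real n ^ (r - 1)) * real (n choose (r - 1))"
    proof -
      have "\<epsilon> ^ (r - 1) \<le> \<epsilon>" using \<epsilon> eps r3 power_decreasing[of 1 "r - 1" \<epsilon>] by simp
      then show ?thesis unfolding power_mult_distrib by (intro mult_right_mono) auto
    qed
    finally show ?thesis using n by (simp add: field_simps)
  qed
  have "(\<Sum>e\<in>cls x c. if e \<subseteq> Y then 1 else 0) = real (card {e \<in> cls x c. e \<subseteq> Y})" for x c
    using finite_uniform_edges[of r n] by (subst sum.inter_filter[symmetric]) (auto simp: colour_class_def)
  then have "measure_pmf.prob M {(x, c). t * y \<le> real (card {e \<in> cls x c. e \<subseteq> Y})}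
    \<le> exp (- (t * y) + p * measure_pmf.prob col K * (\<Sum>e\<in>U. exp (if e \<subseteq> Y then 1 else 0) - 1))"
    using upper_tail[of "\<lambda>e. if e \<subseteq> Y then 1 else 0" "t * y"] by simp
  also have "\<dots> \<le> exp (- (t * y / 2))"
  proof -
    have "(\<Sum>e\<in>U. exp (if e \<subseteq> Y then 1 else 0) - 1) = (\<Sum>e\<in>U. if e \<subseteq> Y then exp 1 - 1 else (0 :: real))"
      by (intro sum.cong) auto
    also have "\<dots> = (exp 1 - 1) * real (card Y choose r)"
      using card_edges_inside[OF Y(1), of r] finite_uniform_edges[of r n]
      by (simp flip: sum.inter_filter)
    also have "\<dots> \<le> 2 * (y * (\<epsilon> * real (n choose (r - 1))))"
      using choose_Suc_le[of "card Y" "r - 1"] r exp_minus_one_le ratio y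
      by (intro mult_mono) (auto simp: y_def intro: order_trans mult_left_mono)
    finally have "p * measure_pmf.prob col K * (\<Sum>e\<in>U. exp (if e \<subseteq> Y then 1 else 0) - 1)
      \<le> p * measure_pmf.prob col K * (2 * (y * (\<epsilon> * real (n choose (r - 1)))))"
      using p by (intro mult_left_mono) auto
    also have "\<dots> = 2 * y * \<epsilon> * D" by (simp flip: D)
    also have "\<dots> \<le> t * y / 2" using t y by (simp add: field_simps)
    finally show ?thesis by simp
  qed
  finally show ?thesis by (simp add: y_def)
qed

text \<open>The counts at different vertices are dependent, because one hyperedge may be trapped at
  up to \<open>r\<close> vertices of \<open>A\<close>. Double counting turns their sum into a sum
  over independent hyperedges with weights \<open>w e\<close> of at most \<open>r\<close>.\<close>

lemma trapped_edges:
  fixes W :: "nat \<Rightarrow> nat set"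
  assumes A: "A \<subseteq> {1..n}" and W: "\<And>a. a \<in> A \<Longrightarrow> finite (W a) \<and> card (W a) \<le> n div 2"
    and \<gamma>: "0 < \<gamma>" and l: "0 < l" "l * real r \<le> 1" "l * real r \<le> \<gamma> / 8"
  shows "measure_pmf.prob M {(x, c). real (card A) * (1 / 2 ^ (r - 1) + \<gamma> / 4) * D
       \<le> (\<Sum>a\<in>A. real (card {e \<in> cls x c. a \<in> e \<and> e \<subseteq> insert a (W a)}))}
    \<le> exp (- (l * \<gamma> / 8 * real (card A) * D))"
proof -
  define \<kappa> :: real where "\<kappa> = 1 / 2 ^ (r - 1)"
  have \<kappa>: "0 < \<kappa>" "\<kappa> \<le> 1" by (auto simp: \<kappa>_def)
  have finA: "finite A" using A finite_subset by blast
  define w where "w = (\<lambda>e. real (card {a \<in> A. a \<in> e \<and> e \<subseteq> insert a (W a)}))"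
  have swap: "(\<Sum>e\<in>S. w e) = (\<Sum>a\<in>A. real (card {e \<in> S. a \<in> e \<and> e \<subseteq> insert a (W a)}))"
    if "finite S" for S
  proof -
    have "(\<Sum>e\<in>S. w e) = (\<Sum>e\<in>S. \<Sum>a\<in>A. if a \<in> e \<and> e \<subseteq> insert a (W a) then 1 else 0)"
      unfolding w_def using finA by (simp flip: sum.inter_filter)
    also have "\<dots> = (\<Sum>a\<in>A. \<Sum>e\<in>S. if a \<in> e \<and> e \<subseteq> insert a (W a) then 1 else 0)"
      by (rule sum.swap)
    finally show ?thesis using that by (simp flip: sum.inter_filter)
  qed
  have w_le: "w e \<le> real r" if "e \<in> U" for e
  proof -
    have "card {a \<in> A. a \<in> e \<and> e \<subseteq> insert a (W a)} \<le> card e"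
      using that finite_subset[of e "{1..n}"] by (intro card_mono) (auto simp: uniform_edges_def)
    then show ?thesis using that by (simp add: w_def uniform_edges_def)
  qed
  have w0: "0 \<le> w e" for e by (simp add: w_def)
  have finc: "finite (cls x c)" for x c
    using finite_uniform_edges[of r n] by (auto simp: colour_class_def)
  define t where "t = real (card A) * (\<kappa> + \<gamma> / 4) * D"
  have "{(x, c). t \<le> (\<Sum>a\<in>A. real (card {e \<in> cls x c. a \<in> e \<and> e \<subseteq> insert a (W a)}))}
      = {(x, c). l * t \<le> (\<Sum>e\<in>cls x c. l * w e)}"
    using l(1) by (simp add: swap[OF finc] flip: sum_distrib_left)
  then have "measure_pmf.prob M {(x, c). t \<le> (\<Sum>a\<in>A. real (card {e \<in> cls x c. a \<in> e \<and> e \<subseteq> insert a (W a)}))}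
      \<le> exp (- (l * t) + p * measure_pmf.prob col K * (\<Sum>e\<in>U. exp (l * w e) - 1))"
    using upper_tail[of "\<lambda>e. l * w e" "l * t"] w0 l by simp
  also have "\<dots> \<le> exp (- (l * \<gamma> / 8 * real (card A) * D))"
  proof -
    \<comment> \<open>As \<open>l * w e\<close> is at most 1 and at most \<gamma> / 8, the quadratic
      term of the exponential costs a factor \<open>1 + \<gamma> / 8\<close>, which consumes no more
      than half of the surplus \<gamma> / 4 in the threshold.\<close>
    have "exp (l * w e) - 1 \<le> (l * (1 + \<gamma> / 8)) * w e" if "e \<in> U" for e
    proof -
      have lw: "0 \<le> l * w e" "l * w e \<le> l * real r" using w0 w_le[OF that] l by auto
      then have "exp (l * w e) \<le> 1 + l * w e + (l * w e)\<^sup>2"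
        using l(2) by (intro exp_bound) linarith+
      also have "(l * w e)\<^sup>2 \<le> (l * w e) * (\<gamma> / 8)"
        unfolding power2_eq_square using lw l by (intro mult_left_mono) linarith+
      finally show ?thesis by (simp add: algebra_simps)
    qed
    then have "(\<Sum>e\<in>U. exp (l * w e) - 1) \<le> (\<Sum>e\<in>U. (l * (1 + \<gamma> / 8)) * w e)"
      by (rule sum_mono)
    also have "\<dots> = (l * (1 + \<gamma> / 8)) * (\<Sum>a\<in>A. real (card {e \<in> U. a \<in> e \<and> e \<subseteq> insert a (W a)}))"
      using swap[OF finite_uniform_edges] by (simp flip: sum_distrib_left)
    also have "\<dots> \<le> (l * (1 + \<gamma> / 8)) * (\<Sum>a\<in>A. \<kappa> * real (n choose (r - 1)))"
    proof (intro mult_left_mono sum_mono)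
      fix a assume a: "a \<in> A"
      have "card {e \<in> U. a \<in> e \<and> e \<subseteq> insert a (W a)} \<le> card (W a) choose (r - 1)"
        using W[OF a] r by (intro card_edges_at_inside) auto
      also have "\<dots> \<le> (n div 2) choose (r - 1)"
        using W[OF a] by (intro binomial_right_mono) auto
      finally have "real (card {e \<in> U. a \<in> e \<and> e \<subseteq> insert a (W a)}) \<le> real ((n div 2) choose (r - 1))"
        by simp
      also have "\<dots> \<le> \<kappa> * real (n choose (r - 1))"
        using choose_half_le[of n "r - 1"] by (simp add: \<kappa>_def)
      finally show "real (card {e \<in> U. a \<in> e \<and> e \<subseteq> insert a (W a)}) \<le> \<kappa> * real (n choose (r - 1))" .
    qed (use l \<gamma> in auto)
    finally have "p * measure_pmf.prob col K * (\<Sum>e\<in>U. exp (l * w e) - 1)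
       \<le> p * measure_pmf.prob col K * ((l * (1 + \<gamma> / 8)) * (\<Sum>a\<in>A. \<kappa> * real (n choose (r - 1))))"
      using p by (intro mult_left_mono) auto
    also have "\<dots> = l * (1 + \<gamma> / 8) * real (card A) * \<kappa> * D" by (simp flip: D)
    also have "\<dots> = l * real (card A) * D * (\<kappa> + \<kappa> * \<gamma> / 8)" by (simp add: algebra_simps)
    also have "\<dots> \<le> l * real (card A) * D * (\<kappa> + \<gamma> / 8)"
      using \<kappa> \<gamma> l D_nonneg by (intro mult_left_mono) auto
    finally show ?thesis by (simp add: t_def algebra_simps)
  qed
  finally show ?thesis by (simp add: t_def \<kappa>_def)
qed

lemma trapped_family:
  assumes \<Phi>: "finite \<Phi>" and \<gamma>: "0 < \<gamma>" and l: "0 < l" "l * real r \<le> 1" "l * real r \<le> \<gamma> / 8"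
    and m: "\<epsilon> * real n \<le> real (Suc m)"
  shows "measure_pmf.prob M
      {(x, c). \<not> untrapped n (n div 2) m ((1 / 2 ^ (r - 1) + \<gamma> / 4) * D) \<Phi> (cls x c)}
    \<le> real (card \<Phi>) * exp (- (l * \<gamma> / 8 * \<epsilon> * real n * D))"
proof -
  define \<Psi> where "\<Psi> = {(A, W) \<in> \<Phi>. A \<subseteq> {1..n} \<and> m < card A \<and>
    (\<forall>a\<in>A. finite (W a) \<and> card (W a) \<le> n div 2)}"
  define B where "B = (\<lambda>(A, W). {(x, c). real (card A) * (1 / 2 ^ (r - 1) + \<gamma> / 4) * D
       \<le> (\<Sum>a\<in>A. real (card {e \<in> cls x c. a \<in> e \<and> e \<subseteq> insert a (W a)}))})"
  have sub: "\<Psi> \<subseteq> \<Phi>" by (auto simp: \<Psi>_def)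
  have fin: "finite \<Psi>" using sub \<Phi> finite_subset by blast
  have "{(x, c). \<not> untrapped n (n div 2) m ((1 / 2 ^ (r - 1) + \<gamma> / 4) * D) \<Phi> (cls x c)} \<subseteq> (\<Union>z\<in>\<Psi>. B z)"
    unfolding untrapped_def \<Psi>_def B_def by (fastforce simp: not_less mult.assoc)
  then have "measure_pmf.prob M
      {(x, c). \<not> untrapped n (n div 2) m ((1 / 2 ^ (r - 1) + \<gamma> / 4) * D) \<Phi> (cls x c)}
    \<le> measure_pmf.prob M (\<Union>z\<in>\<Psi>. B z)"
    by (intro measure_pmf.finite_measure_mono) auto
  also have "\<dots> \<le> (\<Sum>z\<in>\<Psi>. measure_pmf.prob M (B z))"
    by (rule measure_UNION_le[OF fin]) simp
  also have "\<dots> \<le> (\<Sum>z\<in>\<Psi>. exp (- (l * \<gamma> / 8 * \<epsilon> * real n * D)))"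
  proof (rule sum_mono)
    fix z assume z: "z \<in> \<Psi>"
    obtain A W where AW: "z = (A, W)" by (cases z)
    have "measure_pmf.prob M (B z) \<le> exp (- (l * \<gamma> / 8 * real (card A) * D))"
      using trapped_edges[of A W \<gamma> l] z \<gamma> l by (auto simp: \<Psi>_def B_def AW)
    also have "\<dots> \<le> exp (- (l * \<gamma> / 8 * (\<epsilon> * real n) * D))"
    proof -
      have "\<epsilon> * real n \<le> real (card A)" using z m by (auto simp: \<Psi>_def AW)
      then have "l * \<gamma> / 8 * (\<epsilon> * real n) * D \<le> l * \<gamma> / 8 * real (card A) * D"
        using l \<gamma> D_nonneg by (intro mult_right_mono mult_left_mono) auto
      then show ?thesis by simp
    qed
    finally show "measure_pmf.prob M (B z) \<le> exp (- (l * \<gamma> / 8 * \<epsilon> * real n * D))"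
      by (simp add: mult.assoc)
  qed
  also have "\<dots> \<le> real (card \<Phi>) * exp (- (l * \<gamma> / 8 * \<epsilon> * real n * D))"
    using card_mono[OF \<Phi> sub] by (simp add: mult_right_mono)
  finally show ?thesis .
qed

text \<open>All sizes are summed at once: with q = exp (- t / 2), the terms
  \<open>q ^ card Y\<close> over the nonempty \<open>Y\<close> add up to (1 + q)^n - 1.\<close>

lemma many_inside_some:
  assumes r3: "r \<ge> 3" and \<epsilon>: "3 * real m \<le> \<epsilon> * real n" "\<epsilon> \<le> 1" and t: "4 * \<epsilon> * D \<le> t"
  shows "measure_pmf.prob M {(x, c). \<exists>Y. Y \<subseteq> {1..n} \<and> Y \<noteq> {} \<and> card Y \<le> 3 * m \<and>
      t * real (card Y) \<le> real (card {e \<in> cls x c. e \<subseteq> Y})} \<le> exp (real n * exp (- (t / 2))) - 1"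
proof -
  define \<Psi> where "\<Psi> = {Y. Y \<subseteq> {1..n} \<and> Y \<noteq> {} \<and> card Y \<le> 3 * m}"
  define B where "B = (\<lambda>Y. {(x, c). t * real (card Y) \<le> real (card {e \<in> cls x c. e \<subseteq> Y})})"
  have fin: "finite \<Psi>" by (rule finite_subset[of _ "Pow {1..n}"]) (auto simp: \<Psi>_def)
  have "{(x, c). \<exists>Y. Y \<subseteq> {1..n} \<and> Y \<noteq> {} \<and> card Y \<le> 3 * m \<and>
      t * real (card Y) \<le> real (card {e \<in> cls x c. e \<subseteq> Y})} = (\<Union>Y\<in>\<Psi>. B Y)"
    by (auto simp: \<Psi>_def B_def)
  then have "measure_pmf.prob M {(x, c). \<exists>Y. Y \<subseteq> {1..n} \<and> Y \<noteq> {} \<and> card Y \<le> 3 * m \<and>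
      t * real (card Y) \<le> real (card {e \<in> cls x c. e \<subseteq> Y})} \<le> (\<Sum>Y\<in>\<Psi>. measure_pmf.prob M (B Y))"
    using measure_UNION_le[OF fin, of B M] by simp
  also have "\<dots> \<le> (\<Sum>Y\<in>\<Psi>. exp (- (t / 2)) ^ card Y)"
  proof (rule sum_mono)
    fix Y assume Y: "Y \<in> \<Psi>"
    then have "real (card Y) \<le> real (3 * m)" unfolding \<Psi>_def by (intro of_nat_mono) auto
    then have "real (card Y) \<le> \<epsilon> * real n" using \<epsilon> by simp
    then have "measure_pmf.prob M (B Y) \<le> exp (- (t * real (card Y) / 2))"
      unfolding B_def using Y r3 \<epsilon> t by (intro many_inside) (auto simp: \<Psi>_def)
    also have "\<dots> = exp (- (t / 2)) ^ card Y"
      by (simp flip: exp_of_nat_mult)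
    finally show "measure_pmf.prob M (B Y) \<le> exp (- (t / 2)) ^ card Y" .
  qed
  also have "\<dots> \<le> (\<Sum>Y\<in>Pow {1..n} - {{}}. exp (- (t / 2)) ^ card Y)"
    by (intro sum_mono2) (auto simp: \<Psi>_def)
  also have "\<dots> = (\<Sum>Y\<in>Pow {1..n}. exp (- (t / 2)) ^ card Y) - 1"
    by (subst sum_diff) auto
  also have "(\<Sum>Y\<in>Pow {1..n}. exp (- (t / 2)) ^ card Y) = (\<Prod>i\<in>{1..n}. exp (- (t / 2)) + 1)"
    by (subst prod_add) (auto intro!: sum.cong)
  also have "\<dots> = (\<Prod>i\<in>{1..n}. 1 + exp (- (t / 2)))" by (simp add: add.commute)
  also have "\<dots> \<le> exp (\<Sum>i\<in>{1..n}. exp (- (t / 2)))"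
    by (intro prod_one_plus_le_exp) (auto intro: order_trans[of _ 0])
  finally show ?thesis by simp
qed

end

section \<open>Deterministic conditions for a Hamilton Berge cycle\<close>

definition lists_upto :: "'a set \<Rightarrow> nat \<Rightarrow> 'a list set" where
  "lists_upto X N = {xs. set xs \<subseteq> X \<and> length xs \<le> N}"

lemma finite_lists_upto: "finite X \<Longrightarrow> finite (lists_upto X N)"
  unfolding lists_upto_def by (rule finite_lists_length_le)

text \<open>Shorter lists can be padded by one additional letter, which is why the base has to
  exceed \<open>card X\<close>.\<close>

lemma card_lists_upto:
  assumes "finite X" "card X < M"
  shows "card (lists_upto X N) \<le> M ^ N"
proof -
  have "(\<Sum>i\<le>N. card X ^ i) \<le> (Suc (card X)) ^ N"
  proof (induction N)
    case (Suc N)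
    have "card X ^ N \<le> Suc (card X) ^ N" by (intro power_mono) auto
    then have "card X * card X ^ N \<le> card X * Suc (card X) ^ N" by (rule mult_le_mono2)
    then show ?case using Suc by (simp only: sum.atMost_Suc power_Suc mult_Suc add_mono)
  qed simp
  also have "\<dots> \<le> M ^ N" using assms by (intro power_mono) auto
  finally show ?thesis unfolding lists_upto_def using assms by (simp add: card_lists_length_le)
qed

lemma lists_upto_setE:
  assumes "S \<subseteq> X" "finite S" "card S \<le> N"
  obtains xs where "xs \<in> lists_upto X N" "set xs = S"
proof -
  obtain xs where "set xs = S" "distinct xs" using finite_distinct_list[OF assms(2)] by auto
  then show ?thesis using that assms distinct_card[of xs] by (auto simp: lists_upto_def)
qed

text \<open>The sets at the ends of rotated paths only depend on a sparse set of hyperedges, hence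
  on a short list; these families collect all sets that can occur in the three steps of the proof.\<close>

definition rotation_family :: "nat \<Rightarrow> nat \<Rightarrow> nat \<Rightarrow> (nat set \<times> (nat \<Rightarrow> nat set)) set" where
  "rotation_family r n N =
     (\<lambda>(Rs, vs, es, ts). (endpoints (set Rs) (vs, es), pivots (set Rs) (vs, es) (set ts))) `
       (lists_upto ({1..n} \<times> uniform_edges r n) N \<times> lists_upto {1..n} n \<times>
        lists_upto (uniform_edges r n) n \<times> lists_upto {1..n} n) \<union>
     (\<lambda>ws. (set ws, \<lambda>_. set ws)) ` lists_upto {1..n} n"

definition closing_family :: "nat \<Rightarrow> nat \<Rightarrow> nat \<Rightarrow> nat \<Rightarrow> (nat set \<times> (nat \<Rightarrow> nat set)) set" where
  "closing_family r n N N' =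
     (\<lambda>(Rs, vs, es, fs). (endpoints (set Rs) (vs, es),
        \<lambda>a. {1..n} - other_ends (set Rs) (vs, es) (set fs) a)) `
       (lists_upto ({1..n} \<times> uniform_edges r n) N \<times> lists_upto {1..n} n \<times>
        lists_upto (uniform_edges r n) n \<times> lists_upto (uniform_edges r n) N')"

text \<open>One strict bound for all three alphabets lets the numbers of lists multiply to a single
  power.\<close>

lemma card_alphabet:
  assumes "n \<ge> 2"
  shows "card ({1..n} \<times> uniform_edges r n) < n ^ (r + 2)" "card (uniform_edges r n) < n ^ (r + 2)"
    "card {1..n} < n ^ (r + 2)"
proof -
  have "n choose r \<le> n ^ r" by (cases "r \<le> n") (auto simp: binomial_le_pow binomial_eq_0)
  then have "n * (n choose r) \<le> n * n ^ r" by simp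
  also have "\<dots> < n * (n * n ^ r)" using assms by simp
  finally have *: "n * (n choose r) < n ^ (r + 2)" by simp
  then show "card ({1..n} \<times> uniform_edges r n) < n ^ (r + 2)"
    by (simp add: card_cartesian_product card_uniform_edges)
  have "n choose r \<le> n * (n choose r)" using assms by simp
  then show "card (uniform_edges r n) < n ^ (r + 2)"
    unfolding card_uniform_edges using * by (rule le_less_trans)
  have "n ^ 1 < n ^ (r + 2)" using assms by (intro power_strict_increasing) auto
  then show "card {1..n} < n ^ (r + 2)" by simp
qed

lemma finite_alphabet:
  "finite ({1..n} \<times> uniform_edges r n)" "finite (uniform_edges r n)" "finite {1..n}"
  using finite_uniform_edges by auto

text \<open>The exponent adds the list lengths: \<open>N\<close> for the assignment and
  \<open>n\<close> each for the vertices of the path, its hyperedges and the target set. The factor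
  2 covers the sets that serve as their own confining sets.\<close>

lemma rotation_family_card:
  assumes "n \<ge> 2"
  shows "finite (rotation_family r n N)" "card (rotation_family r n N) \<le> 2 * (n ^ (r + 2)) ^ (N + 3 * n)"
proof -
  let ?M = "n ^ (r + 2)"
  let ?X = "lists_upto ({1..n} \<times> uniform_edges r n) N \<times> lists_upto {1..n} n \<times>
        lists_upto (uniform_edges r n) n \<times> lists_upto {1..n} n"
  note c = card_lists_upto[OF finite_alphabet(1) card_alphabet(1)[OF assms]]
    card_lists_upto[OF finite_alphabet(2) card_alphabet(2)[OF assms]]
    card_lists_upto[OF finite_alphabet(3) card_alphabet(3)[OF assms]]
  have fin: "finite ?X" "finite (lists_upto {1..n} n)"
    by (intro finite_cartesian_product finite_lists_upto finite_alphabet)+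
  then show "finite (rotation_family r n N)" by (simp add: rotation_family_def)
  have "card ?X \<le> ?M ^ N * (?M ^ n * (?M ^ n * ?M ^ n))"
    unfolding card_cartesian_product by (intro mult_le_mono c)
  also have "\<dots> = ?M ^ (N + 3 * n)"
    by (simp only: power_add[symmetric]) (simp add: numeral_3_eq_3)
  finally have 1: "card ?X \<le> ?M ^ (N + 3 * n)" .
  have "card (lists_upto {1..n} n) \<le> ?M ^ n" by (rule c)
  also have "\<dots> \<le> ?M ^ (N + 3 * n)" using assms by (intro power_increasing) auto
  finally have 2: "card (lists_upto {1..n} n) \<le> ?M ^ (N + 3 * n)" .
  have "card (rotation_family r n N) \<le> card ?X + card (lists_upto {1..n} n)"
    unfolding rotation_family_def
    by (rule order_trans[OF card_Un_le]) (intro add_mono card_image_le fin)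
  then show "card (rotation_family r n N) \<le> 2 * ?M ^ (N + 3 * n)" using 1 2 by linarith
qed

lemma closing_family_card:
  assumes "n \<ge> 2"
  shows "finite (closing_family r n N N')"
    "card (closing_family r n N N') \<le> (n ^ (r + 2)) ^ (N + N' + 2 * n)"
proof -
  let ?M = "n ^ (r + 2)"
  let ?X = "lists_upto ({1..n} \<times> uniform_edges r n) N \<times> lists_upto {1..n} n \<times>
        lists_upto (uniform_edges r n) n \<times> lists_upto (uniform_edges r n) N'"
  note c = card_lists_upto[OF finite_alphabet(1) card_alphabet(1)[OF assms]]
    card_lists_upto[OF finite_alphabet(2) card_alphabet(2)[OF assms]]
    card_lists_upto[OF finite_alphabet(3) card_alphabet(3)[OF assms]]
  have fin: "finite ?X"
    by (intro finite_cartesian_product finite_lists_upto finite_alphabet)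
  then show "finite (closing_family r n N N')" by (simp add: closing_family_def)
  have "card (closing_family r n N N') \<le> card ?X"
    unfolding closing_family_def by (rule card_image_le[OF fin])
  also have "\<dots> \<le> ?M ^ N * (?M ^ n * (?M ^ n * ?M ^ N'))"
    unfolding card_cartesian_product by (intro mult_le_mono c)
  also have "\<dots> = ?M ^ (N + N' + 2 * n)"
    by (simp only: power_add[symmetric]) (simp add: add_ac mult_2)
  finally show "card (closing_family r n N N') \<le> ?M ^ (N + N' + 2 * n)" .
qed

section \<open>Escaping from confining sets\<close>

lemma sum_degrees_le:
  assumes "finite A" "finite B" "\<And>e. e \<in> B \<Longrightarrow> finite e \<and> card e \<le> r"
  shows "(\<Sum>a\<in>A. real (card {e \<in> B. a \<in> e})) \<le> real r * real (card B)"
proof -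
  have "(\<Sum>a\<in>A. real (card {e \<in> B. a \<in> e})) = (\<Sum>a\<in>A. \<Sum>e\<in>B. if a \<in> e then 1 else 0)"
    using assms by (simp flip: sum.inter_filter)
  also have "\<dots> = (\<Sum>e\<in>B. \<Sum>a\<in>A. if a \<in> e then 1 else 0)" by (rule sum.swap)
  also have "\<dots> = (\<Sum>e\<in>B. real (card {a \<in> A. a \<in> e}))"
    using assms by (simp flip: sum.inter_filter)
  also have "\<dots> \<le> (\<Sum>e\<in>B. real r)"
  proof (intro sum_mono)
    fix e assume "e \<in> B"
    then have "card {a \<in> A. a \<in> e} \<le> card e" "card e \<le> r"
      using assms(3) by (auto intro!: card_mono)
    then show "real (card {a \<in> A. a \<in> e}) \<le> real r" by linarith
  qed
  finally show ?thesis by (simp add: mult.commute)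
qed

text \<open>If nothing escaped, the degrees in \<open>F\<close> at \<open>A\<close> would be covered
  by trapped hyperedges of \<open>F'\<close> and by hyperedges of \<open>B\<close>. The trapped ones
  account for less than \<open>t\<close> per vertex on average, and \<open>B\<close> contributes at
  most \<open>r * n\<close> in total; the surplus \<open>s\<close>, collected over at least
  \<open>Suc m\<close> vertices, exceeds that.\<close>

lemma untrapped_escape:
  assumes un: "untrapped n h m t \<Phi> F'" and sub: "F \<subseteq> F'" "F' \<subseteq> uniform_edges r n"
    and deg: "\<And>a. a \<in> {1..n} \<Longrightarrow> t + s \<le> real (card {e \<in> F. a \<in> e})"
    and AW: "(A, W) \<in> \<Phi>" "A \<subseteq> {1..n}" "m < card A" "\<And>a. a \<in> A \<Longrightarrow> finite (W a) \<and> card (W a) \<le> h"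
    and B: "B \<subseteq> uniform_edges r n" "card B \<le> n" and s: "real r * real n \<le> s * real (Suc m)" "0 \<le> s"
  shows "\<exists>a\<in>A. \<exists>e\<in>F - B. a \<in> e \<and> \<not> e \<subseteq> insert a (W a)"
proof (rule ccontr)
  assume no: "\<not> ?thesis"
  have finA: "finite A" using AW(2) finite_subset by blast
  have finF: "finite F'" using sub(2) finite_uniform_edges finite_subset by blast
  have finB: "finite B" using B(1) finite_uniform_edges finite_subset by blast
  have "real (card A) * (t + s) \<le> (\<Sum>a\<in>A. real (card {e \<in> F. a \<in> e}))"
    using deg AW(2) by (subst sum_constant[symmetric]) (intro sum_mono, auto)
  also have "\<dots> \<le> (\<Sum>a\<in>A. real (card {e \<in> F'. a \<in> e \<and> e \<subseteq> insert a (W a)}) + real (card {e \<in> B. a \<in> e}))"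
  proof (intro sum_mono)
    fix a assume "a \<in> A"
    then have "{e \<in> F. a \<in> e} \<subseteq> {e \<in> F'. a \<in> e \<and> e \<subseteq> insert a (W a)} \<union> {e \<in> B. a \<in> e}"
      using no sub by blast
    then have "card {e \<in> F. a \<in> e} \<le> card ({e \<in> F'. a \<in> e \<and> e \<subseteq> insert a (W a)} \<union> {e \<in> B. a \<in> e})"
      using finF finB by (intro card_mono) auto
    also have "\<dots> \<le> card {e \<in> F'. a \<in> e \<and> e \<subseteq> insert a (W a)} + card {e \<in> B. a \<in> e}"
      by (rule card_Un_le)
    finally show "real (card {e \<in> F. a \<in> e})
        \<le> real (card {e \<in> F'. a \<in> e \<and> e \<subseteq> insert a (W a)}) + real (card {e \<in> B. a \<in> e})" by simp
  qed
  also have "\<dots> < real (card A) * t + real r * real (card B)"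
  proof -
    have "(\<Sum>a\<in>A. real (card {e \<in> F'. a \<in> e \<and> e \<subseteq> insert a (W a)})) < real (card A) * t"
      using un AW unfolding untrapped_def by fast
    moreover have "(\<Sum>a\<in>A. real (card {e \<in> B. a \<in> e})) \<le> real r * real (card B)"
      using B(1) finA finB
      by (intro sum_degrees_le) (auto simp: uniform_edges_def dest: finite_subset)
    ultimately show ?thesis by (simp add: sum.distrib)
  qed
  finally have "real (card A) * s < real r * real (card B)" by (simp add: algebra_simps)
  also have "\<dots> \<le> real r * real n" using B(2) by (intro mult_left_mono) auto
  also have "\<dots> \<le> s * real (Suc m)" by (rule s)
  also have "\<dots> \<le> real (card A) * s" using AW(3) s(2) by (subst mult.commute) (intro mult_right_mono, auto)
  finally show False by simp
qed

text \<open>Colour \<open>j < r\<close> puts a hyperedge into the first class and assigns it to its \<open>j\<close>-th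
  smallest vertex (counting from \<open>0\<close>); colours \<open>r\<close> and \<open>Suc r\<close> are the second and third class.\<close>

definition well_spread ::
  "nat \<Rightarrow> nat \<Rightarrow> nat \<Rightarrow> nat \<Rightarrow> nat \<Rightarrow> nat \<Rightarrow> real \<Rightarrow> real \<Rightarrow> (nat set \<Rightarrow> bool) \<Rightarrow> (nat set \<Rightarrow> nat) \<Rightarrow> bool" where
  "well_spread r n k m N N' t2 t3 x c \<longleftrightarrow>
     (let cls = colour_class x c (uniform_edges r n) in
       (\<forall>Y. Y \<subseteq> {1..n} \<longrightarrow> Y \<noteq> {} \<longrightarrow> card Y \<le> 3 * m \<longrightarrow>
          3 * card {e \<in> cls {..<r}. e \<subseteq> Y} < (k - 1) * card Y) \<and>
       card (cls {..<r}) \<le> N \<and> card (cls {r}) \<le> N' \<and>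
       untrapped n (n div 2) m t2 (rotation_family r n N) (cls {r}) \<and>
       untrapped n (n div 2) m t3 (closing_family r n N N') (cls {Suc r}))"

definition large_degrees ::
  "nat \<Rightarrow> nat \<Rightarrow> nat \<Rightarrow> real \<Rightarrow> real \<Rightarrow> nat set set \<Rightarrow> (nat set \<Rightarrow> nat) \<Rightarrow> bool" where
  "large_degrees r n k d2 d3 E c \<longleftrightarrow> (\<forall>v\<in>{1..n}.
     k \<le> card {e \<in> E. v \<in> e \<and> c e < r \<and> sorted_list_of_set e ! c e = v} \<and>
     d2 \<le> real (card {e \<in> E. v \<in> e \<and> c e = r}) \<and>
     d3 \<le> real (card {e \<in> E. v \<in> e \<and> c e = Suc r}))"

lemma finite_pivots: "finite (pivots R P T s)"
  by (rule finite_subset[of _ "fst ` succs (fst (path_to R P s))"])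
    (force simp: pivots_def succs_def)+

text \<open>The subgraph influences the confining sets only through the path, the assignment
  \<open>R\<close> and the class \<open>F\<close>, all of bounded length. So every set that can
  occur belongs to a family over which \<open>well_spread\<close> already quantifies, whatever
  \<open>E\<close> is.\<close>

lemma well_spread_hamilton:
  assumes n: "n \<ge> 2" and k: "k > 0" and E: "E \<subseteq> {e \<in> uniform_edges r n. x e}"
    and ws: "well_spread r n k m N N' t2 t3 x c"
    and deg: "large_degrees r n k (t2 + s2) (t3 + s3) E c"
    and s2: "0 \<le> s2" "real r * real n \<le> s2 * real (Suc m)"
    and s3: "0 \<le> s3" "real r * real n \<le> s3 * real (Suc m)"
  shows "has_hamilton_berge_cycle ({1..n}, E)"
proof -
  let ?cls = "colour_class x c (uniform_edges r n)"
  define R where "R = {(v, e). e \<in> E \<and> v \<in> e \<and> c e < r \<and> sorted_list_of_set e ! c e = v}"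
  define F where "F = {e \<in> E. c e = r}"
  define G where "G = {e \<in> E. c e = Suc r}"
  have EU: "E \<subseteq> uniform_edges r n" using E by auto
  have finE: "finite E" using EU finite_uniform_edges finite_subset by blast
  have E_edge: "e \<subseteq> {1..n}" if "e \<in> E" for e using that EU by (auto simp: uniform_edges_def)
  have Rcls: "snd ` R \<subseteq> ?cls {..<r}" and Fcls: "F \<subseteq> ?cls {r}" and Gcls: "G \<subseteq> ?cls {Suc r}"
    using E by (auto simp: R_def F_def G_def colour_class_def)
  have clsU: "?cls K \<subseteq> uniform_edges r n" for K by (auto simp: colour_class_def)
  have fincls: "finite (?cls K)" for K using clsU finite_uniform_edges finite_subset by blast
  note ws' = ws[unfolded well_spread_def Let_def]
  have Rsub: "R \<subseteq> {1..n} \<times> uniform_edges r n" using E_edge EU by (auto simp: R_def)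
  have finR: "finite R" by (rule finite_subset[OF Rsub finite_alphabet(1)])
  have cardR: "card R \<le> N"
  proof -
    have "card R = card (snd ` R)" by (rule card_image[symmetric]) (auto simp: R_def inj_on_def)
    also have "\<dots> \<le> card (?cls {..<r})" by (rule card_mono[OF fincls Rcls])
    finally show ?thesis using ws' by linarith
  qed
  obtain Rs where Rs: "Rs \<in> lists_upto ({1..n} \<times> uniform_edges r n) N" "set Rs = R"
    using lists_upto_setE[OF Rsub finR cardR] .
  have FU: "F \<subseteq> uniform_edges r n" using EU by (auto simp: F_def)
  have cardF: "card F \<le> N'" using card_mono[OF fincls Fcls] ws' by linarith
  obtain fs where fs: "fs \<in> lists_upto (uniform_edges r n) N'" "set fs = F"
    using lists_upto_setE[OF FU _ cardF] finite_subset[OF FU finite_uniform_edges] by blast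
  have Fdeg: "t2 + s2 \<le> real (card {e \<in> F. a \<in> e})" and Gdeg: "t3 + s3 \<le> real (card {e \<in> G. a \<in> e})"
    if "a \<in> {1..n}" for a
    using deg that unfolding large_degrees_def F_def G_def by (simp_all add: conj_ac)
  interpret berge_expander "{1..n}" E R F G k m
  proof
    show "k \<le> card {e. (v, e) \<in> R}" if "v \<in> {1..n}" for v
      using deg that unfolding large_degrees_def R_def by simp
    show "3 * card {e \<in> snd ` R. e \<subseteq> Y} < (k - 1) * card Y"
      if "Y \<subseteq> {1..n}" "Y \<noteq> {}" "card Y \<le> 3 * m" for Y
    proof -
      have "card {e \<in> snd ` R. e \<subseteq> Y} \<le> card {e \<in> ?cls {..<r}. e \<subseteq> Y}"
        using Rcls fincls by (intro card_mono) auto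
      then show ?thesis using ws' that by (meson le_less_trans mult_le_mono2)
    qed
  qed (use n k E_edge in \<open>auto simp: R_def F_def G_def\<close>)
  have path_lists: "fst P \<in> lists_upto {1..n} n" "snd P \<in> lists_upto (uniform_edges r n) n"
    "card (set (snd P)) \<le> n" "set (snd P) \<subseteq> uniform_edges r n" if P: "berge_path P" for P
  proof -
    have "distinct (fst P)" "set (fst P) \<subseteq> {1..n}" using P unfolding berge_path_def by auto
    then have "length (fst P) \<le> n"
      using card_mono[of "{1..n}" "set (fst P)"] distinct_card[of "fst P"] by auto
    moreover have "length (fst P) = Suc (length (snd P))"
      using P linked_length[of _ "fst P" "snd P"] unfolding berge_path_def by blast
    moreover have "set (snd P) \<subseteq> E" using P unfolding berge_path_def by blast
    ultimately show "fst P \<in> lists_upto {1..n} n" "snd P \<in> lists_upto (uniform_edges r n) n"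
      "card (set (snd P)) \<le> n" "set (snd P) \<subseteq> uniform_edges r n"
      using \<open>set (fst P) \<subseteq> {1..n}\<close> EU card_length[of "snd P"] by (auto simp: lists_upto_def)
  qed
  interpret berge_closing "{1..n}" E R F G k m
  proof
    show "F \<inter> G = {}" by (auto simp: F_def G_def)
    show "\<exists>s\<in>endpoints R P. \<exists>e\<in>F - set (snd P). s \<in> e \<and> \<not> e \<subseteq> insert s (pivots R P T s)"
      if P: "berge_path P" and T: "T \<subseteq> {1..n}" and m: "m < card (endpoints R P)"
        and h: "\<forall>s\<in>endpoints R P. card (pivots R P T s) \<le> card {1..n} div 2" for P T
    proof (rule untrapped_escape[where \<Phi> = "rotation_family r n N"])
      obtain ts where ts: "ts \<in> lists_upto {1..n} n" "set ts = T"
        using lists_upto_setE[OF T] card_mono[OF _ T] finite_subset[OF T] by auto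
      show "(endpoints R P, pivots R P T) \<in> rotation_family r n N"
        unfolding rotation_family_def
      proof (intro UnI1 image_eqI)
        show "(Rs, fst P, snd P, ts) \<in> lists_upto ({1..n} \<times> uniform_edges r n) N \<times> lists_upto {1..n} n \<times>
            lists_upto (uniform_edges r n) n \<times> lists_upto {1..n} n"
          using Rs ts path_lists[OF P] by auto
      qed (use Rs ts in auto)
      show "untrapped n (n div 2) m t2 (rotation_family r n N) (?cls {r})" using ws' by blast
    qed (use Fcls clsU Fdeg endpoints_subset[OF P] m h path_lists[OF P] s2 finite_pivots[of R P T] in auto)
    show "\<exists>w\<in>W. \<exists>e\<in>F - B. w \<in> e \<and> \<not> e \<subseteq> W"
      if W: "W \<subseteq> {1..n}" "m < card W" "card W \<le> card {1..n} div 2"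
        and B: "B \<subseteq> E" "card B \<le> card {1..n}" for W B
    proof -
      have finW: "finite W" using W(1) finite_subset by blast
      \<comment> \<open>For \<open>w \<in> W\<close> the set \<open>insert w W\<close> is
        \<open>W\<close> itself, so \<open>W\<close> acts as its own confining set.\<close>
      have "\<exists>w\<in>W. \<exists>e\<in>F - B. w \<in> e \<and> \<not> e \<subseteq> insert w W"
      proof (rule untrapped_escape[where \<Phi> = "rotation_family r n N"])
        obtain ts where ts: "ts \<in> lists_upto {1..n} n" "set ts = W"
          using lists_upto_setE[OF W(1) finW] card_mono[OF _ W(1)] by auto
        then show "(W, \<lambda>_. W) \<in> rotation_family r n N"
          unfolding rotation_family_def by (intro UnI2 image_eqI[where x = ts]) auto
        show "untrapped n (n div 2) m t2 (rotation_family r n N) (?cls {r})" using ws' by blast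
      qed (use Fcls clsU Fdeg W finW B EU s2 in auto)
      then show ?thesis by auto
    qed
    show "\<exists>a\<in>endpoints R P. \<exists>e\<in>G - set (snd P). a \<in> e \<and>
        \<not> e \<subseteq> insert a ({1..n} - other_ends R P F a)"
      if P: "berge_path P" and m: "m < card (endpoints R P)"
        and h: "\<forall>a\<in>endpoints R P. card ({1..n} - other_ends R P F a) \<le> card {1..n} div 2" for P
    proof (rule untrapped_escape[where \<Phi> = "closing_family r n N N'"])
      show "(endpoints R P, \<lambda>a. {1..n} - other_ends R P F a) \<in> closing_family r n N N'"
        unfolding closing_family_def
      proof (intro image_eqI)
        show "(Rs, fst P, snd P, fs) \<in> lists_upto ({1..n} \<times> uniform_edges r n) N \<times> lists_upto {1..n} n \<times>
            lists_upto (uniform_edges r n) n \<times> lists_upto (uniform_edges r n) N'"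
          using Rs fs path_lists[OF P] by auto
      qed (use Rs fs in auto)
      show "untrapped n (n div 2) m t3 (closing_family r n N N') (?cls {Suc r})" using ws' by blast
    qed (use Gcls clsU Gdeg endpoints_subset[OF P] m h path_lists[OF P] s3 in auto)
  qed
  from hamilton_cycle show ?thesis
    unfolding has_hamilton_berge_cycle_def hamilton_berge_cycle_def by simp
qed

section \<open>The failure probability\<close>

text \<open>The colour \<open>Suc (Suc r)\<close> takes the remaining probability; its hyperedges
  belong to no class.\<close>

lemma colour_distribution:
  fixes q1 q2 q3 :: real
  assumes r: "r > 0" and q: "0 \<le> q1" "0 \<le> q2" "0 \<le> q3" "q1 + q2 + q3 \<le> 1"
  obtains col :: "nat pmf" where "finite (set_pmf col)"
    "\<And>j. j < r \<Longrightarrow> measure_pmf.prob col {j} = q1 / real r"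
    "measure_pmf.prob col {..<r} = q1" "measure_pmf.prob col {r} = q2"
    "measure_pmf.prob col {Suc r} = q3"
proof -
  define f :: "nat \<Rightarrow> real" where "f = (\<lambda>j. if j < r then q1 / real r else if j = r then q2
    else if j = Suc r then q3 else if j = Suc (Suc r) then 1 - q1 - q2 - q3 else 0)"
  have f0: "0 \<le> f j" for j using q by (auto simp: f_def)
  have "(\<Sum>j<Suc (Suc (Suc r)). f j) = 1"
    using r by (simp add: f_def)
  moreover have "(\<integral>\<^sup>+ j. ennreal (f j) \<partial>count_space UNIV) = (\<Sum>j<Suc (Suc (Suc r)). ennreal (f j))"
    by (intro nn_integral_count_space') (auto simp: f_def)
  ultimately have "(\<integral>\<^sup>+ j. ennreal (f j) \<partial>count_space UNIV) = 1"
    using sum_ennreal[of "{..<Suc (Suc (Suc r))}" f] f0 by simp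
  note pmf = pmf_embed_pmf[OF f0 this] and set = set_embed_pmf[OF f0 this]
  show ?thesis
  proof (rule that[of "embed_pmf f"])
    show "finite (set_pmf (embed_pmf f))"
      unfolding set by (rule finite_subset[of _ "{..Suc (Suc r)}"]) (auto simp: f_def)
    show "measure_pmf.prob (embed_pmf f) {..<r} = q1"
      using r by (simp add: measure_measure_pmf_finite pmf) (simp add: f_def)
  qed (simp_all add: measure_pmf_single pmf, simp_all add: f_def)
qed

lemma large_degrees_probability:
  fixes d :: real
  assumes r: "r > 0" and col: "finite (set_pmf col)" and E: "E \<subseteq> uniform_edges r n"
    and deg: "\<And>v. v \<in> {1..n} \<Longrightarrow> (1 / 2 ^ (r - 1) + \<gamma>) * d \<le> real (card {e \<in> E. v \<in> e})"
    and q: "\<And>j. j < r \<Longrightarrow> measure_pmf.prob col {j} = q1 / real r"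
      "measure_pmf.prob col {r} = q2" "measure_pmf.prob col {Suc r} = q3"
    and D: "q1 * d = D1" "q2 * d = D2" "q3 * d = D3" "0 \<le> d" "0 \<le> q1" and \<gamma>: "0 < \<gamma>"
    and k: "real k \<le> D1 / (real r * 2 ^ r)"
  shows "measure_pmf.prob (Pi_pmf (uniform_edges r n) 0 (\<lambda>_. col))
     {c. \<not> large_degrees r n k ((1 / 2 ^ (r - 1) + \<gamma> / 2) * D2) ((1 / 2 ^ (r - 1) + \<gamma> / 2) * D3) E c}
    \<le> real n * (exp (- (D1 / (8 * real r * 2 ^ r))) + exp (- (\<gamma>\<^sup>2 / (16 * (1 / 2 ^ (r - 1) + \<gamma>)) * D2))
         + exp (- (\<gamma>\<^sup>2 / (16 * (1 / 2 ^ (r - 1) + \<gamma>)) * D3)))"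
proof -
  let ?C = "Pi_pmf (uniform_edges r n) 0 (\<lambda>_. col)"
  define \<kappa> :: real where "\<kappa> = 1 / 2 ^ (r - 1)"
  have \<kappa>: "0 < \<kappa>" by (simp add: \<kappa>_def)
  have pow: "2 * (2 :: real) ^ (r - 1) = 2 ^ r" using r by (cases r) auto
  define S where "S = (\<lambda>v. {e \<in> E. v \<in> e})"
  have SU: "S v \<subseteq> uniform_edges r n" for v using E by (auto simp: S_def)
  \<comment> \<open>At least \<open>\<kappa> * D1 / r\<close> hyperedges are expected to be assigned
    to \<open>v\<close>; half of this is \<open>D1 / (r * 2 ^ r)\<close>, the bound on
    \<open>k\<close>.\<close>
  define B1 where "B1 = (\<lambda>v. {c. real (card {e \<in> S v. c e \<in> {j. j < r \<and> sorted_list_of_set e ! j = v}})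
      \<le> (1 - 1 / 2) * (\<kappa> * D1 / real r)})"
  \<comment> \<open>The relative deviation leads from the factor \<open>\<kappa> + \<gamma>\<close>
    exactly to \<open>\<kappa> + \<gamma> / 2\<close>, which still exceeds the fraction \<kappa>
    that can be trapped.\<close>
  define B2 where "B2 = (\<lambda>(j :: nat) D v. {c :: nat set \<Rightarrow> nat. real (card {e \<in> S v. c e \<in> {j}})
      \<le> (1 - \<gamma> / (2 * (\<kappa> + \<gamma>))) * ((\<kappa> + \<gamma>) * D)})"
  have P1: "measure_pmf.prob ?C (B1 v) \<le> exp (- (D1 / (8 * real r * 2 ^ r)))" if v: "v \<in> {1..n}" for v
  proof -
    have "measure_pmf.prob ?C (B1 v) \<le> exp (- ((1 / 2)\<^sup>2 * (\<kappa> * D1 / real r) / 4))"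
      unfolding B1_def
    proof (rule colours_lower_tail[OF finite_uniform_edges col SU])
      fix e assume e: "e \<in> S v"
      let ?xs = "sorted_list_of_set e"
      have "finite e" "card e = r" using e E finite_subset[of e "{1..n}"] by (auto simp: S_def uniform_edges_def)
      then have xs: "set ?xs = e" "length ?xs = r" "distinct ?xs" by auto
      then obtain i where i: "i < r" "?xs ! i = v"
        using e by (metis (no_types, lifting) S_def in_set_conv_nth mem_Collect_eq)
      \<comment> \<open>\<open>v\<close> has exactly one position in the sorted list of
        \<open>e\<close>, so exactly one colour below \<open>r\<close> assigns \<open>e\<close> to
        \<open>v\<close>.\<close>
      then have "{j. j < r \<and> ?xs ! j = v} = {i}"
        using xs nth_eq_iff_index_eq[OF xs(3)] by auto
      then show "measure_pmf.prob col {j. j < r \<and> ?xs ! j = v} = q1 / real r"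
        using q(1)[OF i(1)] by simp
    next
      have "\<kappa> * d \<le> (\<kappa> + \<gamma>) * d" using \<gamma> D by (intro mult_right_mono) auto
      also have "\<dots> \<le> real (card (S v))" using deg[OF v] by (simp add: \<kappa>_def S_def)
      finally have "(\<kappa> * d) * (q1 / real r) \<le> real (card (S v)) * (q1 / real r)"
        using D by (intro mult_right_mono) auto
      then show "\<kappa> * D1 / real r \<le> real (card (S v)) * (q1 / real r)"
        by (simp add: algebra_simps flip: D(1))
      have "0 \<le> D1" using D by auto
      then show "0 \<le> \<kappa> * D1 / real r" using \<kappa> by simp
    qed simp
    also have "(1 / 2)\<^sup>2 * (\<kappa> * D1 / real r) / 4 = D1 / (8 * real r * 2 ^ r)"
      by (simp add: \<kappa>_def power2_eq_square field_simps flip: pow)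
    finally show ?thesis .
  qed
  have P2: "measure_pmf.prob ?C (B2 j D v) \<le> exp (- (\<gamma>\<^sup>2 / (16 * (\<kappa> + \<gamma>)) * D))"
    if v: "v \<in> {1..n}" and j: "measure_pmf.prob col {j} = q" "q * d = D" for j q D v
  proof -
    have q0: "0 \<le> q" using j(1) by auto
    have "measure_pmf.prob ?C (B2 j D v) \<le> exp (- ((\<gamma> / (2 * (\<kappa> + \<gamma>)))\<^sup>2 * ((\<kappa> + \<gamma>) * D) / 4))"
      unfolding B2_def
    proof (rule colours_lower_tail[OF finite_uniform_edges col SU])
      have "((\<kappa> + \<gamma>) * d) * q \<le> real (card (S v)) * q"
        using deg[OF v] q0 by (intro mult_right_mono) (auto simp: \<kappa>_def S_def)
      then show "(\<kappa> + \<gamma>) * D \<le> real (card (S v)) * q" by (simp add: mult_ac flip: j(2))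
      show "0 \<le> (\<kappa> + \<gamma>) * D" using \<kappa> \<gamma> q0 D(4) j(2) by auto
    qed (use j \<kappa> \<gamma> in auto)
    also have "(\<gamma> / (2 * (\<kappa> + \<gamma>)))\<^sup>2 * ((\<kappa> + \<gamma>) * D) / 4 = \<gamma>\<^sup>2 / (16 * (\<kappa> + \<gamma>)) * D"
    proof -
      have "(\<gamma> / (2 * s))\<^sup>2 * (s * D) / 4 = \<gamma>\<^sup>2 / (16 * s) * D" if "0 < s" for s
        using that by (simp add: power2_eq_square field_simps)
      from this[OF add_pos_pos[OF \<kappa> \<gamma>]] show ?thesis .
    qed
    finally show ?thesis .
  qed
  have sub: "{c. \<not> large_degrees r n k ((\<kappa> + \<gamma> / 2) * D2) ((\<kappa> + \<gamma> / 2) * D3) E c}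
     \<subseteq> (\<Union>v\<in>{1..n}. B1 v \<union> B2 r D2 v \<union> B2 (Suc r) D3 v)"
  proof
    fix c assume "c \<in> {c. \<not> large_degrees r n k ((\<kappa> + \<gamma> / 2) * D2) ((\<kappa> + \<gamma> / 2) * D3) E c}"
    then obtain v where v: "v \<in> {1..n}" and
      "card {e \<in> E. v \<in> e \<and> c e < r \<and> sorted_list_of_set e ! c e = v} < k
       \<or> real (card {e \<in> E. v \<in> e \<and> c e = r}) < (\<kappa> + \<gamma> / 2) * D2
       \<or> real (card {e \<in> E. v \<in> e \<and> c e = Suc r}) < (\<kappa> + \<gamma> / 2) * D3"
      unfolding large_degrees_def by (auto simp: not_le)
    moreover have "{e \<in> E. v \<in> e \<and> c e < r \<and> sorted_list_of_set e ! c e = v}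
        = {e \<in> S v. c e \<in> {j. j < r \<and> sorted_list_of_set e ! j = v}}" by (auto simp: S_def)
    moreover have "{e \<in> E. v \<in> e \<and> c e = j} = {e \<in> S v. c e \<in> {j}}" for j by (auto simp: S_def)
    moreover have "real k \<le> (1 - 1 / 2) * (\<kappa> * D1 / real r)"
      using k r by (simp add: \<kappa>_def field_simps flip: pow)
    moreover have "(\<kappa> + \<gamma> / 2) * D = (1 - \<gamma> / (2 * (\<kappa> + \<gamma>))) * ((\<kappa> + \<gamma>) * D)" for D
      using \<kappa> \<gamma> by (simp add: field_simps)
    ultimately have "c \<in> B1 v \<union> B2 r D2 v \<union> B2 (Suc r) D3 v"
      unfolding B1_def B2_def by auto
    then show "c \<in> (\<Union>v\<in>{1..n}. B1 v \<union> B2 r D2 v \<union> B2 (Suc r) D3 v)" using v by blast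
  qed
  have "measure_pmf.prob ?C {c. \<not> large_degrees r n k ((\<kappa> + \<gamma> / 2) * D2) ((\<kappa> + \<gamma> / 2) * D3) E c}
     \<le> measure_pmf.prob ?C (\<Union>v\<in>{1..n}. B1 v \<union> B2 r D2 v \<union> B2 (Suc r) D3 v)"
    by (intro measure_pmf.finite_measure_mono sub) auto
  also have "\<dots> \<le> (\<Sum>v\<in>{1..n}. measure_pmf.prob ?C (B1 v \<union> B2 r D2 v \<union> B2 (Suc r) D3 v))"
    by (rule measure_UNION_le) auto
  also have "\<dots> \<le> (\<Sum>v\<in>{1..n}. exp (- (D1 / (8 * real r * 2 ^ r)))
      + exp (- (\<gamma>\<^sup>2 / (16 * (\<kappa> + \<gamma>)) * D2)) + exp (- (\<gamma>\<^sup>2 / (16 * (\<kappa> + \<gamma>)) * D3)))"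
  proof (rule sum_mono)
    fix v assume v: "v \<in> {1..n}"
    have "measure_pmf.prob ?C (B1 v \<union> B2 r D2 v \<union> B2 (Suc r) D3 v)
       \<le> measure_pmf.prob ?C (B1 v) + measure_pmf.prob ?C (B2 r D2 v) + measure_pmf.prob ?C (B2 (Suc r) D3 v)"
      by (intro order_trans[OF measure_Un_le] add_mono) auto
    then show "measure_pmf.prob ?C (B1 v \<union> B2 r D2 v \<union> B2 (Suc r) D3 v)
       \<le> exp (- (D1 / (8 * real r * 2 ^ r)))
      + exp (- (\<gamma>\<^sup>2 / (16 * (\<kappa> + \<gamma>)) * D2)) + exp (- (\<gamma>\<^sup>2 / (16 * (\<kappa> + \<gamma>)) * D3))"
      using P1[OF v] P2[OF v q(2) D(2)] P2[OF v q(3) D(3)] by linarith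
  qed
  finally show ?thesis by (simp add: \<kappa>_def)
qed

text \<open>The logarithms of the family sizes are of order n ln^3 n and n ln^5 n, against n ln^4 n
  and n ln^6 n in the tail bounds. The first term vanishes because n exp (- b ln^2 n / 6)
  does.\<close>

lemma failure_bound_tendsto:
  fixes b c R :: real
  assumes "0 < b" "0 < c" "0 < R"
  shows "(\<lambda>n. 2 * ((exp (real n * exp (- (b * ln (real n) ^ 2 / 6))) - 1) + exp (- (real n * ln (real n) ^ 2))
       + exp (- (real n * ln (real n) ^ 4))
       + 2 * exp (R * ln (real n) * (4 * real n * ln (real n) ^ 2 + 3 * real n)) * exp (- (c * real n * ln (real n) ^ 4))
       + exp (R * ln (real n) * (4 * real n * ln (real n) ^ 2 + 4 * real n * ln (real n) ^ 4 + 2 * real n))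
         * exp (- (c * real n * ln (real n) ^ 6)))) \<longlonglongrightarrow> 0"
  using assms by real_asymp

lemma degree_failure_tendsto:
  fixes a c :: real
  assumes "0 < a" "0 < c"
  shows "(\<lambda>n. real n * (exp (- (ln (real n) ^ 2 / a)) + exp (- (c * ln (real n) ^ 4)) + exp (- (c * ln (real n) ^ 6)))) \<longlonglongrightarrow> 0"
  using assms by real_asymp

lemma eventually_log_power_ge:
  fixes a c :: real
  assumes "0 < a"
  shows "\<forall>\<^sub>F n in sequentially. c \<le> a * ln (real n) ^ 2"
    "\<forall>\<^sub>F n in sequentially. c \<le> a * ln (real n) ^ 4"
    "\<forall>\<^sub>F n in sequentially. c \<le> a * ln (real n) ^ 6"
    "\<forall>\<^sub>F n in sequentially. 1 \<le> ln (real n)"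
    "\<forall>\<^sub>F n in sequentially. ln (real n) ^ 2 + ln (real n) ^ 4 + ln (real n) ^ 6 \<le> ln (real n) ^ 7 / a"
proof -
  have "filterlim (\<lambda>n. a * ln (real n) ^ 2) at_top sequentially" "filterlim (\<lambda>n. a * ln (real n) ^ 4) at_top sequentially"
    "filterlim (\<lambda>n. a * ln (real n) ^ 6) at_top sequentially"
    using assms by real_asymp+
  then show "\<forall>\<^sub>F n in sequentially. c \<le> a * ln (real n) ^ 2"
    "\<forall>\<^sub>F n in sequentially. c \<le> a * ln (real n) ^ 4" "\<forall>\<^sub>F n in sequentially. c \<le> a * ln (real n) ^ 6"
    by (auto simp: filterlim_at_top)
  show "\<forall>\<^sub>F n in sequentially. 1 \<le> ln (real n)" by real_asymp
  show "\<forall>\<^sub>F n in sequentially. ln (real n) ^ 2 + ln (real n) ^ 4 + ln (real n) ^ 6 \<le> ln (real n) ^ 7 / a"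
    using assms by real_asymp
qed
lemma hamilton_failure_probability:
  fixes r n :: nat and p \<gamma> l D1 D2 D3 :: real
  defines "U \<equiv> uniform_edges r n"
  defines "d \<equiv> p * real (n choose (r - 1))"
  defines "b \<equiv> 1 / (real r * 2 ^ (r + 1))"
  assumes r: "r \<ge> 3" and n: "n \<ge> 2" and p: "0 \<le> p" "p \<le> 1" and \<gamma>: "0 < \<gamma>"
    and l: "0 < l" "l * real r \<le> 1" "l * real r \<le> \<gamma> / 8"
    and D: "0 < D1" "0 < D2" "0 < D3" "D1 + D2 + D3 \<le> d"
    and big: "2 \<le> b * D1" "real r \<le> \<gamma> / 4 * D2 * (b / 36)" "real r \<le> \<gamma> / 4 * D3 * (b / 36)"
    and degrees: "real n * (exp (- (D1 / (8 * real r * 2 ^ r))) + exp (- (\<gamma>\<^sup>2 / (16 * (1 / 2 ^ (r - 1) + \<gamma>)) * D2))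
         + exp (- (\<gamma>\<^sup>2 / (16 * (1 / 2 ^ (r - 1) + \<gamma>)) * D3))) < 1 / 2"
  shows "measure_pmf.prob (Pi_pmf U False (\<lambda>_. bernoulli_pmf p))
      {x. \<exists>E. E \<subseteq> {e \<in> U. x e} \<and> (\<forall>v\<in>{1..n}. (1 / 2 ^ (r - 1) + \<gamma>) * d \<le> real (card {e \<in> E. v \<in> e})) \<and>
         \<not> has_hamilton_berge_cycle ({1..n}, E)}
    \<le> 2 * ((exp (real n * exp (- (b * D1 / 6))) - 1) + exp (- (real n * D1)) + exp (- (real n * D2))
       + 2 * exp (real (r + 2) * ln (real n) * (4 * real n * D1 + 3 * real n)) * exp (- (l * \<gamma> / 8 * (b / 36) * real n * D2))
       + exp (real (r + 2) * ln (real n) * (4 * real n * D1 + 4 * real n * D2 + 2 * real n)) * exp (- (l * \<gamma> / 8 * (b / 36) * real n * D3)))"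
proof -
  define \<kappa> :: real where "\<kappa> = 1 / 2 ^ (r - 1)"
  have r0: "r > 0" using r by simp
  have d0: "0 < d" using D by linarith
  have "1 * 1 \<le> real r * 2 ^ (r + 1)"
    by (rule mult_mono[OF _ one_le_power]) (use r0 in auto)
  then have b: "0 < b" "b \<le> 1" by (auto simp: b_def)
  obtain col where col: "finite (set_pmf col)"
    "\<And>j. j < r \<Longrightarrow> measure_pmf.prob col {j} = (D1 / d) / real r"
    "measure_pmf.prob col {..<r} = D1 / d" "measure_pmf.prob col {r} = D2 / d"
    "measure_pmf.prob col {Suc r} = D3 / d"
    using colour_distribution[OF r0, of "D1 / d" "D2 / d" "D3 / d"] D d0
    by (auto simp: field_simps)
  have model: "p * q * real (n choose (r - 1)) = X" if "q = X / d" for q X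
  proof -
    have "p * q * real (n choose (r - 1)) = q * d" by (simp add: d_def)
    then show ?thesis using that d0 by simp
  qed
  interpret c1: colour_class_model r n p col "{..<r}" D1
    by unfold_locales (use r0 p col model in auto)
  interpret c2: colour_class_model r n p col "{r}" D2
    by unfold_locales (use r0 p col model in auto)
  interpret c3: colour_class_model r n p col "{Suc r}" D3
    by unfold_locales (use r0 p col model in auto)
  let ?X = "Pi_pmf U False (\<lambda>_. bernoulli_pmf p)" and ?C = "Pi_pmf U 0 (\<lambda>_. col)"
  let ?M = "pair_pmf ?X ?C"
  \<comment> \<open>The constants fit together as follows. \<open>k\<close> is close to
    \<open>2 * b * D1\<close>, that is \<open>D1 / (r * 2 ^ r)\<close>, so \<open>k - 1\<close> is
    at least \<open>b * D1\<close>. The threshold per vertex for \<open>few_inside\<close> is then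
    \<open>b * D1 / 3\<close>, which equals \<open>4 * \<epsilon> * D1\<close> for
    \<open>\<epsilon> = b / 12\<close>, and \<open>3 * m \<le> \<epsilon> * n\<close> leads to
    \<open>b / 36\<close>.\<close>
  define m where "m = nat \<lfloor>b / 36 * real n\<rfloor>"
  define k where "k = nat \<lfloor>2 * b * D1\<rfloor>"
  define N where "N = nat \<lfloor>4 * real n * D1\<rfloor>"
  define N' where "N' = nat \<lfloor>4 * real n * D2\<rfloor>"
  have m: "real m \<le> b / 36 * real n" "b / 36 * real n \<le> real (Suc m)"
    using b n unfolding m_def by (auto simp: le_nat_floor) linarith+
  have k: "real k \<le> 2 * b * D1" "b * D1 \<le> real k - 1" "0 < k"
  proof -
    show "real k \<le> 2 * b * D1" using b D unfolding k_def by simp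
    \<comment> \<open>Rounding down and passing from \<open>k\<close> to \<open>k - 1\<close> lose
      at most 2, which \<open>2 \<le> b * D1\<close> makes up for.\<close>
    have "2 * b * D1 \<le> real k + 1" unfolding k_def by linarith
    then show *: "b * D1 \<le> real k - 1" using big(1) by linarith
    show "0 < k" using * big(1) by linarith
  qed
  have N: "real N \<le> 4 * real n * D1" "real N' \<le> 4 * real n * D2"
    using D unfolding N_def N'_def by simp_all
  \<comment> \<open>Half of the surplus \<gamma> / 2 in the degrees goes into the trap thresholds;
    the other half pays for the at most \<open>n\<close> hyperedges already used.\<close>
  define t2 where "t2 = (\<kappa> + \<gamma> / 4) * D2"
  define t3 where "t3 = (\<kappa> + \<gamma> / 4) * D3"
  define cls where "cls = (\<lambda>x c K. colour_class x c U K)"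
  define B1 where "B1 = {(x, c). \<exists>Y. Y \<subseteq> {1..n} \<and> Y \<noteq> {} \<and> card Y \<le> 3 * m \<and>
      b * D1 / 3 * real (card Y) \<le> real (card {e \<in> cls x c {..<r}. e \<subseteq> Y})}"
  define B2 where "B2 = {(x, c). 4 * real n * D1 \<le> real (card (cls x c {..<r}))}"
  define B3 where "B3 = {(x, c). 4 * real n * D2 \<le> real (card (cls x c {r}))}"
  define B4 where "B4 = {(x, c). \<not> untrapped n (n div 2) m t2 (rotation_family r n N) (cls x c {r})}"
  define B5 where "B5 = {(x, c). \<not> untrapped n (n div 2) m t3 (closing_family r n N N') (cls x c {Suc r})}"
  define bad where "bad = {(x, c). \<not> well_spread r n k m N N' t2 t3 x c}"
  have "bad \<subseteq> B1 \<union> B2 \<union> B3 \<union> B4 \<union> B5"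
  proof (rule subsetI, rule ccontr)
    fix z assume z: "z \<in> bad" "z \<notin> B1 \<union> B2 \<union> B3 \<union> B4 \<union> B5"
    obtain x c where "z = (x, c)" by (cases z)
    then have *: "(x, c) \<in> bad" "(x, c) \<notin> B1" "(x, c) \<notin> B2" "(x, c) \<notin> B3" "(x, c) \<notin> B4" "(x, c) \<notin> B5"
      using z by auto
    have "well_spread r n k m N N' t2 t3 x c"
      unfolding well_spread_def Let_def
    proof (intro conjI allI impI)
      fix Y assume Y: "Y \<subseteq> {1..n}" "Y \<noteq> {}" "card Y \<le> 3 * m"
      have "\<not> b * D1 / 3 * real (card Y) \<le> real (card {e \<in> cls x c {..<r}. e \<subseteq> Y})"
        using *(2) Y unfolding B1_def mem_Collect_eq case_prod_conv by blast
      then have "3 * real (card {e \<in> cls x c {..<r}. e \<subseteq> Y}) < b * D1 * real (card Y)"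
        by (simp add: not_le)
      also have "\<dots> \<le> (real k - 1) * real (card Y)" using k by (intro mult_right_mono) auto
      finally have "real (3 * card {e \<in> cls x c {..<r}. e \<subseteq> Y}) < real ((k - 1) * card Y)"
        using k by (simp add: of_nat_diff)
      then show "3 * card {e \<in> colour_class x c (uniform_edges r n) {..<r}. e \<subseteq> Y} < (k - 1) * card Y"
        unfolding of_nat_less_iff cls_def U_def .
    next
      show "card (colour_class x c (uniform_edges r n) {..<r}) \<le> N"
        using *(3) unfolding N_def B2_def cls_def U_def by (auto simp: le_nat_floor)
      show "card (colour_class x c (uniform_edges r n) {r}) \<le> N'"
        using *(4) unfolding N'_def B3_def cls_def U_def by (auto simp: le_nat_floor)
    qed (use *(5,6) in \<open>auto simp: B4_def B5_def cls_def U_def\<close>)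
    then show False using *(1) by (simp add: bad_def)
  qed
  then have "measure_pmf.prob ?M bad \<le> measure_pmf.prob ?M (B1 \<union> B2 \<union> B3 \<union> B4 \<union> B5)"
    by (intro measure_pmf.finite_measure_mono) auto
  also have "\<dots> \<le> measure_pmf.prob ?M B1 + measure_pmf.prob ?M B2 + measure_pmf.prob ?M B3
      + measure_pmf.prob ?M B4 + measure_pmf.prob ?M B5"
    by (intro order_trans[OF measure_Un_le] add_right_mono) auto
  also have "\<dots> \<le> (exp (real n * exp (- (b * D1 / 6))) - 1) + exp (- (real n * D1)) + exp (- (real n * D2))
       + 2 * exp (real (r + 2) * ln (real n) * (4 * real n * D1 + 3 * real n)) * exp (- (l * \<gamma> / 8 * (b / 36) * real n * D2))
       + exp (real (r + 2) * ln (real n) * (4 * real n * D1 + 4 * real n * D2 + 2 * real n)) * exp (- (l * \<gamma> / 8 * (b / 36) * real n * D3))"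
    (is "_ \<le> ?\<eta>")
  proof (intro add_mono)
    have "3 * real m \<le> b / 12 * real n" using m(1) by simp
    then show "measure_pmf.prob ?M B1 \<le> exp (real n * exp (- (b * D1 / 6))) - 1"
      using c1.many_inside_some[OF r, of m "b / 12" "b * D1 / 3"] b D
      by (simp add: B1_def cls_def U_def)
    show "measure_pmf.prob ?M B2 \<le> exp (- (real n * D1))"
      using c1.many_edges by (simp add: B2_def cls_def U_def)
    show "measure_pmf.prob ?M B3 \<le> exp (- (real n * D2))"
      using c2.many_edges by (simp add: B3_def cls_def U_def)
    have power: "(real n ^ (r + 2)) ^ i \<le> exp (real (r + 2) * ln (real n) * y)" if "real i \<le> y" for i y
    proof -
      have "(real n ^ (r + 2)) ^ i = exp (ln (real n)) ^ ((r + 2) * i)"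
        using n by (simp only: power_mult) simp
      also have "\<dots> = exp (real (r + 2) * ln (real n) * real i)"
        by (simp only: exp_of_nat_mult[symmetric] of_nat_mult mult_ac)
      also have "\<dots> \<le> exp (real (r + 2) * ln (real n) * y)"
        using that n by (simp add: mult_left_mono)
      finally show ?thesis .
    qed
    have "measure_pmf.prob ?M B4
       \<le> real (card (rotation_family r n N)) * exp (- (l * \<gamma> / 8 * (b / 36) * real n * D2))"
      using c2.trapped_family[OF rotation_family_card(1)[OF n, of r N] \<gamma> l m(2)]
      by (simp add: B4_def cls_def U_def t2_def \<kappa>_def)
    also have "\<dots> \<le> 2 * exp (real (r + 2) * ln (real n) * (4 * real n * D1 + 3 * real n))
        * exp (- (l * \<gamma> / 8 * (b / 36) * real n * D2))"
    proof (rule mult_right_mono)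
      have "real (card (rotation_family r n N)) \<le> real (2 * (n ^ (r + 2)) ^ (N + 3 * n))"
        using rotation_family_card(2)[OF n, of r N] by (rule of_nat_mono)
      also have "\<dots> \<le> 2 * exp (real (r + 2) * ln (real n) * (4 * real n * D1 + 3 * real n))"
        using power[of "N + 3 * n" "4 * real n * D1 + 3 * real n"] N by simp
      finally show "real (card (rotation_family r n N))
          \<le> 2 * exp (real (r + 2) * ln (real n) * (4 * real n * D1 + 3 * real n))" .
    qed simp
    finally show "measure_pmf.prob ?M B4 \<le> \<dots>" .
    have "measure_pmf.prob ?M B5
       \<le> real (card (closing_family r n N N')) * exp (- (l * \<gamma> / 8 * (b / 36) * real n * D3))"
      using c3.trapped_family[OF closing_family_card(1)[OF n, of r N N'] \<gamma> l m(2)]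
      by (simp add: B5_def cls_def U_def t3_def \<kappa>_def)
    also have "\<dots> \<le> exp (real (r + 2) * ln (real n) * (4 * real n * D1 + 4 * real n * D2 + 2 * real n))
        * exp (- (l * \<gamma> / 8 * (b / 36) * real n * D3))"
    proof (rule mult_right_mono)
      have "real (card (closing_family r n N N')) \<le> real ((n ^ (r + 2)) ^ (N + N' + 2 * n))"
        using closing_family_card(2)[OF n, of r N N'] by (rule of_nat_mono)
      also have "\<dots> \<le> exp (real (r + 2) * ln (real n) * (4 * real n * D1 + 4 * real n * D2 + 2 * real n))"
        using power[of "N + N' + 2 * n" "4 * real n * D1 + 4 * real n * D2 + 2 * real n"] N by simp
      finally show "real (card (closing_family r n N N'))
          \<le> exp (real (r + 2) * ln (real n) * (4 * real n * D1 + 4 * real n * D2 + 2 * real n))" .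
    qed simp
    finally show "measure_pmf.prob ?M B5 \<le> \<dots>" .
  qed
  finally have bad: "measure_pmf.prob ?M bad \<le> ?\<eta>" .
  \<comment> \<open>If \<open>f x\<close> is below 1/2, then for any admissible \<open>E\<close> the
    bad colourings and those with small degrees do not exhaust all colourings, and one that avoids
    both gives the cycle. So a failing \<open>x\<close> has \<open>f x \<ge> 1 / 2\<close>, and
    Markov's inequality for \<open>f\<close> costs the factor 2.\<close>
  define f where "f = (\<lambda>x. measure_pmf.prob ?C {c. (x, c) \<in> bad})"
  have "{x. \<exists>E. E \<subseteq> {e \<in> U. x e} \<and> (\<forall>v\<in>{1..n}. (\<kappa> + \<gamma>) * d \<le> real (card {e \<in> E. v \<in> e})) \<and>
         \<not> has_hamilton_berge_cycle ({1..n}, E)} \<subseteq> {x \<in> space ?X. 1 / 2 \<le> f x}"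
  proof safe
    fix x E assume E: "E \<subseteq> {e \<in> U. x e}" and deg: "\<forall>v\<in>{1..n}. (\<kappa> + \<gamma>) * d \<le> real (card {e \<in> E. v \<in> e})"
      and no: "\<not> has_hamilton_berge_cycle ({1..n}, E)"
    let ?L = "large_degrees r n k ((\<kappa> + \<gamma> / 2) * D2) ((\<kappa> + \<gamma> / 2) * D3) E"
    show "1 / 2 \<le> f x"
    proof (rule ccontr)
      assume "\<not> 1 / 2 \<le> f x"
      have "measure_pmf.prob ?C {c. \<not> ?L c} < 1 / 2"
        unfolding \<kappa>_def U_def
      proof (rule order_le_less_trans[OF large_degrees_probability[where ?q1.0 = "D1 / d" and ?q2.0 = "D2 / d" and ?q3.0 = "D3 / d"] degrees])
        show "E \<subseteq> uniform_edges r n" using E by (auto simp: U_def)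
        show "real k \<le> D1 / (real r * 2 ^ r)" using k(1) by (simp add: b_def)
        show "(1 / 2 ^ (r - 1) + \<gamma>) * d \<le> real (card {e \<in> E. v \<in> e})" if "v \<in> {1..n}" for v
          using deg that by (simp add: \<kappa>_def)
      qed (use r0 col d0 D \<gamma> in auto)
      moreover have "measure_pmf.prob ?C ({c. \<not> ?L c} \<union> {c. (x, c) \<in> bad})
          \<le> measure_pmf.prob ?C {c. \<not> ?L c} + measure_pmf.prob ?C {c. (x, c) \<in> bad}"
        by (rule measure_Un_le) auto
      ultimately have "measure_pmf.prob ?C ({c. \<not> ?L c} \<union> {c. (x, c) \<in> bad}) < 1"
        using \<open>\<not> 1 / 2 \<le> f x\<close> by (simp add: f_def)
      then have "{c. \<not> ?L c} \<union> {c. (x, c) \<in> bad} \<noteq> UNIV"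
        by (metis measure_pmf.prob_space less_irrefl space_measure_pmf)
      then obtain c where c: "?L c" "well_spread r n k m N N' t2 t3 x c"
        by (auto simp: bad_def)
      have s: "real r * real n \<le> \<gamma> / 4 * D' * real (Suc m)" if "real r \<le> \<gamma> / 4 * D' * (b / 36)" "0 < D'" for D'
      proof -
        have "real r * real n \<le> (\<gamma> / 4 * D' * (b / 36)) * real n" using that by (intro mult_right_mono) auto
        also have "\<dots> = \<gamma> / 4 * D' * (b / 36 * real n)" by simp
        also have "\<dots> \<le> \<gamma> / 4 * D' * real (Suc m)" using that \<gamma> m(2) by (intro mult_left_mono) auto
        finally show ?thesis .
      qed
      have "has_hamilton_berge_cycle ({1..n}, E)"
      proof (rule well_spread_hamilton[OF n k(3) _ c(2)])
        show "E \<subseteq> {e \<in> uniform_edges r n. x e}" using E by (simp add: U_def)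
        show "large_degrees r n k (t2 + \<gamma> / 4 * D2) (t3 + \<gamma> / 4 * D3) E c"
          using c(1) by (simp add: t2_def t3_def algebra_simps)
      qed (use s big D \<gamma> in auto)
      then show False using no by simp
    qed
  qed auto
  then have "measure_pmf.prob ?X {x. \<exists>E. E \<subseteq> {e \<in> U. x e} \<and>
       (\<forall>v\<in>{1..n}. (\<kappa> + \<gamma>) * d \<le> real (card {e \<in> E. v \<in> e})) \<and> \<not> has_hamilton_berge_cycle ({1..n}, E)}
     \<le> measure_pmf.prob ?X {x \<in> space ?X. 1 / 2 \<le> f x}"
    by (intro measure_pmf.finite_measure_mono) auto
  also have "\<dots> \<le> measure_pmf.expectation ?X f / (1 / 2)"
    by (rule integral_Markov_inequality_measure[where A = UNIV])
      (auto simp: f_def intro!: measure_pmf.integrable_const_bound[where B = 1])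
  also have "measure_pmf.expectation ?X f = measure_pmf.prob ?M bad"
    unfolding f_def prob_pair_pmf ..
  finally show ?thesis using bad by (simp add: \<kappa>_def)
qed

theorem theorem1p4:
  fixes r :: nat and \<gamma> :: real and p :: "nat \<Rightarrow> real"
  assumes "r \<ge> 3"
    and "\<gamma> > 0"
    and "\<And>n. 0 \<le> p n \<and> p n \<le> 1"
    and "\<forall>\<^sub>F n in sequentially. p n \<ge> ln (real n) ^ (17 * r) / real n ^ (r - 1)"
  shows "(\<lambda>n. measure_pmf.prob (random_hypergraph r n (p n))
            {G. \<forall>H. spanning_subgraph H G \<longrightarrow>
                  real (min_degree H) \<ge> (1 / 2 ^ (r - 1) + \<gamma>) * p n * real (n choose (r - 1)) \<longrightarrow>
                  has_hamilton_berge_cycle H}) \<longlonglongrightarrow> 1"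
    (is "?P \<longlonglongrightarrow> 1")
proof -
  define b :: real where "b = 1 / (real r * 2 ^ (r + 1))"
  \<comment> \<open>The largest value allowed by both conditions on \<open>l * real r\<close> in the
    bound for trapped hyperedges.\<close>
  define l where "l = min (1 / real r) (\<gamma> / (8 * real r))"
  define c where "c = l * \<gamma> / 8 * (b / 36)"
  define a where "a = \<gamma>\<^sup>2 / (16 * (1 / 2 ^ (r - 1) + \<gamma>))"
  \<comment> \<open>Denominator of the lower bound \<open>(n / (r - 1)) ^ (r - 1)\<close> for the
    binomial coefficient.\<close>
  define C :: real where "C = real (r - 1) ^ (r - 1)"
  define L where "L = (\<lambda>n. ln (real n))"
  have r0: "0 < real r" using assms(1) by simp
  have pos: "0 < b" "0 < l" "0 < c" "0 < a" "0 < C"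
    using r0 assms(1,2) by (auto simp: b_def l_def c_def a_def C_def intro!: divide_pos_pos add_pos_pos)
  have l: "l * real r \<le> 1" "l * real r \<le> \<gamma> / 8"
  proof -
    have "l * real r \<le> 1 / real r * real r" "l * real r \<le> \<gamma> / (8 * real r) * real r"
      unfolding l_def by (intro mult_right_mono; simp)+
    then show "l * real r \<le> 1" "l * real r \<le> \<gamma> / 8" using r0 by auto
  qed
  define err where "err = (\<lambda>n. 2 * ((exp (real n * exp (- (b * L n ^ 2 / 6))) - 1) + exp (- (real n * L n ^ 2))
       + exp (- (real n * L n ^ 4))
       + 2 * exp (real (r + 2) * L n * (4 * real n * L n ^ 2 + 3 * real n)) * exp (- (c * real n * L n ^ 4))
       + exp (real (r + 2) * L n * (4 * real n * L n ^ 2 + 4 * real n * L n ^ 4 + 2 * real n))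
         * exp (- (c * real n * L n ^ 6))))"
  have err: "err \<longlonglongrightarrow> 0"
    unfolding err_def L_def using pos by (intro failure_bound_tendsto) auto
  have degrees: "\<forall>\<^sub>F n in sequentially. real n * (exp (- (L n ^ 2 / (8 * real r * 2 ^ r)))
      + exp (- (a * L n ^ 4)) + exp (- (a * L n ^ 6))) < 1 / 2"
    unfolding L_def using r0 pos by (intro order_tendstoD(2)[OF degree_failure_tendsto]) auto
  have g: "0 < \<gamma> / 4 * (b / 36)" using assms(2) pos by simp
  have "\<forall>\<^sub>F n in sequentially. 1 - err n \<le> ?P n"
    using assms(4) degrees eventually_ge_at_top[of "r + 2"] eventually_log_power_ge(1)[OF pos(1), of 2]
      eventually_log_power_ge(2,3)[OF g, of "real r"] eventually_log_power_ge(4,5)[OF pos(5)]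
  proof eventually_elim
    case (elim n)
    define d where "d = p n * real (n choose (r - 1))"
    have n: "n \<ge> 2" "r - 1 \<le> n" using elim(3) by auto
    have L1: "1 \<le> L n" using elim(7) by (simp add: L_def)
    \<comment> \<open>The seventh power dominates the sum of the three expected degrees, and
      \<open>7 \<le> 17 * r\<close>. The resulting bound by \<open>d\<close> makes the probabilities
      of the three classes add up to at most 1.\<close>
    have "L n ^ 2 + L n ^ 4 + L n ^ 6 \<le> L n ^ 7 / C" using elim(8) by (simp add: L_def)
    also have "\<dots> \<le> L n ^ (17 * r) / C"
      using L1 assms(1) pos by (intro divide_right_mono power_increasing) auto
    also have "\<dots> = L n ^ (17 * r) / real n ^ (r - 1) * (real n / real (r - 1)) ^ (r - 1)"
      using n by (simp add: C_def power_divide)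
    also have "\<dots> \<le> d"
      unfolding d_def
    proof (rule mult_mono)
      show "L n ^ (17 * r) / real n ^ (r - 1) \<le> p n" using elim(1) by (simp add: L_def)
      show "(real n / real (r - 1)) ^ (r - 1) \<le> real (n choose (r - 1))"
        using binomial_ge_n_over_k_pow_k[OF n(2), where 'a = real] by simp
    qed (use assms(3) in auto)
    finally have d: "L n ^ 2 + L n ^ 4 + L n ^ 6 \<le> d" .
    let ?U = "uniform_edges r n"
    let ?X = "Pi_pmf ?U False (\<lambda>_. bernoulli_pmf (p n))"
    define bad where "bad = {x. \<exists>E. E \<subseteq> {e \<in> ?U. x e} \<and>
      (\<forall>v\<in>{1..n}. (1 / 2 ^ (r - 1) + \<gamma>) * d \<le> real (card {e \<in> E. v \<in> e})) \<and>
      \<not> has_hamilton_berge_cycle ({1..n}, E)}"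
    have bad: "measure_pmf.prob ?X bad \<le> err n"
      unfolding bad_def d_def err_def L_def c_def b_def
    proof (rule hamilton_failure_probability)
      show "real n * (exp (- (ln (real n) ^ 2 / (8 * real r * 2 ^ r)))
          + exp (- (\<gamma>\<^sup>2 / (16 * (1 / 2 ^ (r - 1) + \<gamma>)) * ln (real n) ^ 4))
          + exp (- (\<gamma>\<^sup>2 / (16 * (1 / 2 ^ (r - 1) + \<gamma>)) * ln (real n) ^ 6))) < 1 / 2"
        using elim(2) by (simp add: L_def a_def)
      show "ln (real n) ^ 2 + ln (real n) ^ 4 + ln (real n) ^ 6 \<le> p n * real (n choose (r - 1))"
        using d by (simp add: L_def d_def)
      show "2 \<le> 1 / (real r * 2 ^ (r + 1)) * ln (real n) ^ 2" using elim(4) by (simp add: b_def)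
      show "real r \<le> \<gamma> / 4 * ln (real n) ^ 4 * (1 / (real r * 2 ^ (r + 1)) / 36)"
        using elim(5) by (simp add: b_def mult_ac)
      show "real r \<le> \<gamma> / 4 * ln (real n) ^ 6 * (1 / (real r * 2 ^ (r + 1)) / 36)"
        using elim(6) by (simp add: b_def mult_ac)
    qed (use assms n l pos L1 in \<open>auto simp: L_def\<close>)
    have "- bad \<subseteq> (\<lambda>x. ({1..n}, {e \<in> ?U. x e})) -` {G. \<forall>H. spanning_subgraph H G \<longrightarrow>
          real (min_degree H) \<ge> (1 / 2 ^ (r - 1) + \<gamma>) * p n * real (n choose (r - 1)) \<longrightarrow>
          has_hamilton_berge_cycle H}" (is "_ \<subseteq> _ -` ?S")
    proof (rule subsetI, rule vimageI2, rule CollectI, intro allI impI)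
      fix x H
      assume x: "x \<in> - bad" and H: "spanning_subgraph H ({1..n}, {e \<in> ?U. x e})"
        and deg: "real (min_degree H) \<ge> (1 / 2 ^ (r - 1) + \<gamma>) * p n * real (n choose (r - 1))"
      obtain E where E: "H = ({1..n}, E)" "E \<subseteq> {e \<in> ?U. x e}"
        using H by (cases H) (auto simp: spanning_subgraph_def)
      have "(1 / 2 ^ (r - 1) + \<gamma>) * d \<le> real (card {e \<in> E. v \<in> e})" if "v \<in> {1..n}" for v
      proof -
        have "min_degree H \<le> vertex_degree H v"
          unfolding min_degree_def using that by (intro Min_le) (auto simp: E)
        then show ?thesis using deg by (simp add: E vertex_degree_def d_def mult.assoc)
      qed
      then show "has_hamilton_berge_cycle H" using x E unfolding bad_def by blast
    qed
    then have "measure_pmf.prob ?X (- bad) \<le> ?P n"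
      unfolding random_hypergraph_def measure_map_pmf
      by (intro measure_pmf.finite_measure_mono) auto
    moreover have "measure_pmf.prob ?X (- bad) = 1 - measure_pmf.prob ?X bad"
      using measure_pmf.prob_compl[of bad ?X] by (simp add: Compl_eq_Diff_UNIV)
    ultimately show ?case using bad by linarith
  qed
  moreover have "(\<lambda>n. 1 - err n) \<longlonglongrightarrow> 1" using tendsto_diff[OF tendsto_const err, of 1] by simp
  ultimately show ?thesis
    by (intro tendsto_sandwich[of "\<lambda>n. 1 - err n" ?P sequentially "\<lambda>_. 1"]) auto
qed

end
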